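(* Let $p,q\in\mathbb{N}$, let $\alpha_1\in(0,1)$, $\alpha_2=1-\alpha_1$, let $\mathbf{A}\in\mathbb{R}^{p\times p}$ and $\mathbf{B}\in\mathbb{R}^{q\times q}$ be symmetric positive definite, let $\mathbf{T}_1\neq\mathbf{T}_2$ be matrices in $\mathbb{R}^{p\times q}$, and let the random $p\times q$ matrix $\mathbf{X}$ satisfy $$\mathbf{X}\sim\alpha_1\mathcal{N}_{p\times q}(\mathbf{T}_1,\mathbf{A},\mathbf{B})+\alpha_2\mathcal{N}_{p\times q}(\mathbf{T}_2,\mathbf{A},\mathbf{B}).$$ Let $d=\mathrm{rank}(\mathbf{T}_2-\mathbf{T}_1)$ and $\mathbf{W}_{\mathrm{LDA}}=\mathbf{A}^{-1}(\mathbf{T}_2-\mathbf{T}_1)\mathbf{B}^{-1}$. Then: (i) If $|\alpha_1-1/2|<1/\sqrt{12}$ and $\alpha_1\neq 1/2$, then any sequence $(\mathbf{u}_1,\mathbf{v}_1),\ldots,(\mathbf{u}_d,\mathbf{v}_d)$ of $(\mathcal{G}_{1,\mathbf{X}},\mathcal{G}_{2,\mathbf{X}})$-minimizers of $\kappa_{\mathbf{X}}$ satisfies $$\sum_{j=1}^d\frac{s_j\lambda_j\sqrt{1+\alpha_1\alpha_2\lambda_j^2}}{\sqrt{\mathrm{E}([\mathbf{u}_j'\{\mathbf{X}-\mathrm{E}(\mathbf{X})\}\mathbf{v}_j]^2)}}\,\mathbf{u}_j\mathbf{v}_j'=\mathbf{W}_{\mathrm{LDA}},$$ where $s_1,\ldots,s_d\in\{-1,1\}$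 are the signs of the quantities $(\alpha_1-\alpha_2)^{-1}\mathrm{E}([\mathbf{u}_j'\{\mathbf{X}-\mathrm{E}(\mathbf{X})\}\mathbf{v}_j]^3)$. (ii) If $|\alpha_1-1/2|=1/\sqrt{12}$, then $\kappa_{\mathbf{X}}(\mathbf{u},\mathbf{v})=3$ for all $(\mathbf{u},\mathbf{v})\in\mathbb{S}^{p-1}\times\mathbb{S}^{q-1}$. (iii) If $|\alpha_1-1/2|>1/\sqrt{12}$, then any sequence $(\mathbf{u}_1,\mathbf{v}_1),\ldots,(\mathbf{u}_d,\mathbf{v}_d)$ of $(\mathcal{G}_{1,\mathbf{X}},\mathcal{G}_{2,\mathbf{X}})$-maximizers of $\kappa_{\mathbf{X}}$ satisfies $$\sum_{j=1}^d\frac{s_j\lambda_j\sqrt{1+\alpha_1\alpha_2\lambda_j^2}}{\sqrt{\mathrm{E}([\mathbf{u}_j'\{\mathbf{X}-\mathrm{E}(\mathbf{X})\}\mathbf{v}_j]^2)}}\,\mathbf{u}_j\mathbf{v}_j'=\mathbf{W}_{\mathrm{LDA}},$$ where $s_1,\ldots,s_d\in\{-1,1\}$ are the signs of the quantities $(\alpha_1-\alpha_2)^{-1}\mathrm{E}([\mathbf{u}_j'\{\mathbf{X}-\mathrm{E}(\mathbf{X})\}\mathbf{v}_j]^3)$.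
   Context: Prime denotes transpose, $\mathbb{S}^{p-1}$ is the unit sphere of $\mathbb{R}^p$, and $\mathcal{U}_0:=\mathbb{S}^{p-1}\times\mathbb{S}^{q-1}$. $\mathcal{N}_{p\times q}(\mathbf{T},\mathbf{A},\mathbf{B})$ is the distribution of $\mathbf{T}+\mathbf{A}^{1/2}\mathbf{Z}\mathbf{B}^{1/2}$, where the entries of the $p\times q$ random matrix $\mathbf{Z}$ are i.i.d. standard normal and square roots are the symmetric positive definite ones; $\alpha_1 P_1+\alpha_2 P_2$ denotes the mixture distribution. Index: for $(\mathbf{u},\mathbf{v})\in\mathcal{U}_0$, $$\kappa_{\mathbf{X}}(\mathbf{u},\mathbf{v}):=\frac{\mathrm{E}([\mathbf{u}'\{\mathbf{X}-\mathrm{E}(\mathbf{X})\}\mathbf{v}]^4)}{\{\mathrm{E}([\mathbf{u}'\{\mathbf{X}-\mathrm{E}(\mathbf{X})\}\mathbf{v}]^2)\}^2}.$$ Sequences of optimizers: for pairs $(\mathbf{u}_1,\mathbf{v}_1),\ldots,(\mathbf{u}_d,\mathbf{v}_d)\in\mathcal{U}_0$, put, for $k=1,\ldots,d-1$, $$\mathbf{G}_{1k,\mathbf{X}}:=\mathrm{E}[\{\mathbf{X}-\mathrm{E}(\mathbf{X})\}\mathbf{v}_k\mathbf{v}_k'\{\mathbf{X}-\mathrm{E}(\mathbf{X})\}'],\qquad \mathbf{G}_{2k,\mathbf{X}}:=\mathrm{E}[\{\mathbf{X}-\mathrm{E}(\mathbf{X})\}'\mathbf{u}_k\mathbf{u}_k'\{\mathbf{X}-\mathrm{E}(\mathbf{X})\}],$$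 and $\mathcal{G}_{i,\mathbf{X}}=\{\mathbf{G}_{i1,\mathbf{X}},\ldots,\mathbf{G}_{i(d-1),\mathbf{X}}\}$, $i=1,2$. The pairs form a sequence of $(\mathcal{G}_{1,\mathbf{X}},\mathcal{G}_{2,\mathbf{X}})$-minimizers (maximizers) of a function $g:\mathcal{U}_0\to\mathbb{R}$ if $(\mathbf{u}_1,\mathbf{v}_1)$ minimizes (maximizes) $g$ in $\mathcal{U}_0$ and, for each $j=2,\ldots,d$, $(\mathbf{u}_j,\mathbf{v}_j)$ minimizes (maximizes) $g(\mathbf{u},\mathbf{v})$ over those $(\mathbf{u},\mathbf{v})\in\mathcal{U}_0$ with $\mathbf{u}'\mathbf{G}_{1k,\mathbf{X}}\mathbf{u}_k=0$ and $\mathbf{v}'\mathbf{G}_{2k,\mathbf{X}}\mathbf{v}_k=0$ for all $k=1,\ldots,j-1$. Coefficients: for such a sequence, $$\theta_j:=\sqrt{\max\left\{\frac{\kappa_{\mathbf{X}}(\mathbf{u}_j,\mathbf{v}_j)-3}{\alpha_1\alpha_2(1-6\alpha_1\alpha_2)},0\right\}},\qquad \lambda_j:=\sqrt{\max\left\{\frac{\theta_j}{1-\alpha_1\alpha_2\theta_j},0\right\}}.$$ *)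

theory Defs
  imports "HOL-Probability.Probability"
begin

definition outer_prod :: "real^'p \<Rightarrow> real^'q \<Rightarrow> real^'q^'p" where
  "outer_prod u v = (columnvector u :: real^1^'p) ** (rowvector v :: real^'q^1)"

definition sym_pos_def :: "real^'n^'n \<Rightarrow> bool" where
  "sym_pos_def A \<longleftrightarrow> transpose A = A \<and> (\<forall>x. x \<noteq> 0 \<longrightarrow> x \<bullet> (A *v x) > 0)"

definition matrix_sqrt :: "real^'n^'n \<Rightarrow> real^'n^'n" where
  "matrix_sqrt A = (THE S. sym_pos_def S \<and> S ** S = A)"

definition matrix_normal ::
    "real^'q^'p \<Rightarrow> real^'p^'p \<Rightarrow> real^'q^'q \<Rightarrow> (real^'q^'p) measure" where
  "matrix_normal T A B =
     distr (\<Pi>\<^sub>M _\<in> (UNIV :: ('p \<times> 'q) set). density lborel (\<lambda>x. ennreal (std_normal_density x)))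
           borel
           (\<lambda>z. T + matrix_sqrt A ** (\<chi> i j. z (i, j)) ** matrix_sqrt B)"

text \<open>Intended for measures on the same measurable space, with nonnegative weights.\<close>

definition mixture :: "real \<Rightarrow> 'a measure \<Rightarrow> real \<Rightarrow> 'a measure \<Rightarrow> 'a measure" where
  "mixture a1 P1 a2 P2 =
     measure_of (space P1) (sets P1)
       (\<lambda>S. ennreal a1 * emeasure P1 S + ennreal a2 * emeasure P2 S)"

lemma space_mixture [simp]: "space (mixture a1 P1 a2 P2) = space P1"
  and sets_mixture [simp]: "sets (mixture a1 P1 a2 P2) = sets P1"
  by (simp_all add: mixture_def)

lemma emeasure_mixture:
  assumes eq: "sets P2 = sets P1" and S: "S \<in> sets P1"
  shows "emeasure (mixture a1 P1 a2 P2) S =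
           ennreal a1 * emeasure P1 S + ennreal a2 * emeasure P2 S"
  unfolding mixture_def
proof (rule emeasure_measure_of_sigma[OF sets.sigma_algebra_axioms _ _ S])
  show "positive (sets P1) (\<lambda>S. ennreal a1 * emeasure P1 S + ennreal a2 * emeasure P2 S)"
    by (simp add: positive_def)
  show "countably_additive (sets P1)
          (\<lambda>S. ennreal a1 * emeasure P1 S + ennreal a2 * emeasure P2 S)"
    using eq
    by (auto simp: countably_additive_def suminf_add[symmetric] ennreal_suminf_cmult
          suminf_emeasure)
qed

definition centered :: "'a measure \<Rightarrow> ('a \<Rightarrow> real^'q^'p) \<Rightarrow> 'a \<Rightarrow> real^'q^'p" where
  "centered M X \<omega> = X \<omega> - (\<integral>\<omega>'. X \<omega>' \<partial>M)"

definition proj_moment ::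
    "nat \<Rightarrow> 'a measure \<Rightarrow> ('a \<Rightarrow> real^'q^'p) \<Rightarrow> real^'p \<Rightarrow> real^'q \<Rightarrow> real" where
  "proj_moment n M X u v = (\<integral>\<omega>. (u \<bullet> (centered M X \<omega> *v v)) ^ n \<partial>M)"

definition kurt :: "'a measure \<Rightarrow> ('a \<Rightarrow> real^'q^'p) \<Rightarrow> real^'p \<Rightarrow> real^'q \<Rightarrow> real" where
  "kurt M X u v = proj_moment 4 M X u v / (proj_moment 2 M X u v)\<^sup>2"

definition G1 :: "'a measure \<Rightarrow> ('a \<Rightarrow> real^'q^'p) \<Rightarrow> real^'q \<Rightarrow> real^'p^'p" where
  "G1 M X v = (\<integral>\<omega>. centered M X \<omega> ** outer_prod v v ** transpose (centered M X \<omega>) \<partial>M)"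

definition G2 :: "'a measure \<Rightarrow> ('a \<Rightarrow> real^'q^'p) \<Rightarrow> real^'p \<Rightarrow> real^'q^'q" where
  "G2 M X u = (\<integral>\<omega>. transpose (centered M X \<omega>) ** outer_prod u u ** centered M X \<omega> \<partial>M)"

definition feasible ::
    "(nat \<Rightarrow> real^'p^'p) \<Rightarrow> (nat \<Rightarrow> real^'q^'q) \<Rightarrow> (nat \<Rightarrow> real^'p) \<Rightarrow> (nat \<Rightarrow> real^'q) \<Rightarrow> nat
      \<Rightarrow> (real^'p) \<times> (real^'q) \<Rightarrow> bool" where
  "feasible H1 H2 us vs j = (\<lambda>(u, v).
     (u, v) \<in> sphere 0 1 \<times> sphere 0 1 \<and>
     (\<forall>k\<in>{1..<j}. u \<bullet> (H1 k *v us k) = 0 \<and> v \<bullet> (H2 k *v vs k) = 0))"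

text \<open>The pairs are indexed by \<open>1, \<dots>, d\<close>; the values of \<open>us\<close>, \<open>vs\<close> at other indices are
  irrelevant.  For \<open>j = 1\<close> there is no orthogonality constraint.\<close>

definition minimizer_seq ::
    "nat \<Rightarrow> (nat \<Rightarrow> real^'p^'p) \<Rightarrow> (nat \<Rightarrow> real^'q^'q) \<Rightarrow> (real^'p \<Rightarrow> real^'q \<Rightarrow> real)
      \<Rightarrow> (nat \<Rightarrow> real^'p) \<Rightarrow> (nat \<Rightarrow> real^'q) \<Rightarrow> bool" where
  "minimizer_seq d H1 H2 g us vs \<longleftrightarrow>
     (\<forall>j\<in>{1..d}. is_arg_min (\<lambda>(u, v). g u v) (feasible H1 H2 us vs j) (us j, vs j))"

definition maximizer_seq ::
    "nat \<Rightarrow> (nat \<Rightarrow> real^'p^'p) \<Rightarrow> (nat \<Rightarrow> real^'q^'q) \<Rightarrow> (real^'p \<Rightarrow> real^'q \<Rightarrow> real)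
      \<Rightarrow> (nat \<Rightarrow> real^'p) \<Rightarrow> (nat \<Rightarrow> real^'q) \<Rightarrow> bool" where
  "maximizer_seq d H1 H2 g us vs \<longleftrightarrow>
     (\<forall>j\<in>{1..d}. is_arg_max (\<lambda>(u, v). g u v) (feasible H1 H2 us vs j) (us j, vs j))"

definition theta ::
    "'a measure \<Rightarrow> ('a \<Rightarrow> real^'q^'p) \<Rightarrow> real \<Rightarrow> real \<Rightarrow> real^'p \<Rightarrow> real^'q \<Rightarrow> real" where
  "theta M X \<alpha>1 \<alpha>2 u v =
     sqrt (max ((kurt M X u v - 3) / (\<alpha>1 * \<alpha>2 * (1 - 6 * \<alpha>1 * \<alpha>2))) 0)"

definition lam ::
    "'a measure \<Rightarrow> ('a \<Rightarrow> real^'q^'p) \<Rightarrow> real \<Rightarrow> real \<Rightarrow> real^'p \<Rightarrow> real^'q \<Rightarrow> real" where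
  "lam M X \<alpha>1 \<alpha>2 u v =
     sqrt (max (theta M X \<alpha>1 \<alpha>2 u v / (1 - \<alpha>1 * \<alpha>2 * theta M X \<alpha>1 \<alpha>2 u v)) 0)"

definition proj_sign ::
    "'a measure \<Rightarrow> ('a \<Rightarrow> real^'q^'p) \<Rightarrow> real \<Rightarrow> real \<Rightarrow> real^'p \<Rightarrow> real^'q \<Rightarrow> real" where
  "proj_sign M X \<alpha>1 \<alpha>2 u v = sgn (inverse (\<alpha>1 - \<alpha>2) * proj_moment 3 M X u v)"

end

theory Submission
  imports Defs
begin

text \<open>Let \<open>D = T2 - T1\<close>, \<open>\<beta> = \<alpha>1 \<alpha>2\<close>, \<open>\<delta> = u' D v\<close> and \<open>s = (u' A u) (v' B v)\<close>. The centred projection of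
  \<open>X\<close> is a mixture of \<open>N(- \<alpha>2 \<delta>, s)\<close> and \<open>N(\<alpha>1 \<delta>, s)\<close>, so its second moment is \<open>m = s + \<beta> \<delta>\<^sup>2\<close>, its
  third moment is \<open>\<beta> (\<alpha>1 - \<alpha>2) \<delta>\<^sup>3\<close>, and \<open>\<kappa> - 3 = \<beta> (1 - 6 \<beta>) (\<delta>\<^sup>2 / m)\<^sup>2\<close>. The sign of \<open>1 - 6 \<beta>\<close> is the
  sign of \<open>\<bar>\<alpha>1 - 1/2\<bar> - 1 / sqrt 12\<close>; optimizing \<open>\<kappa>\<close> in the stated direction therefore maximizes
  \<open>\<delta>\<^sup>2 / s\<close>. Under \<open>x = A\<^sup>1\<^sup>/\<^sup>2 u\<close>, \<open>y = B\<^sup>1\<^sup>/\<^sup>2 v\<close> the successive optimizers are singular pairs of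
  \<open>A\<^sup>-\<^sup>1\<^sup>/\<^sup>2 D B\<^sup>-\<^sup>1\<^sup>/\<^sup>2\<close>. Since \<open>\<lambda> = \<bar>\<delta>\<bar> / sqrt s\<close>, the coefficient of \<open>u v'\<close> reduces to \<open>\<delta> / s\<close>, and
  the sum is the singular value decomposition of \<open>A\<^sup>-\<^sup>1 D B\<^sup>-\<^sup>1\<close> in these coordinates.\<close>

section \<open>Positive definite square roots\<close>

lemma symmetric_matrix_iff:
  fixes A :: "real^'n^'n"
  shows "transpose A = A \<longleftrightarrow> (\<forall>x y. x \<bullet> (A *v y) = (A *v x) \<bullet> y)"
proof
  assume "transpose A = A"
  then show "\<forall>x y. x \<bullet> (A *v y) = (A *v x) \<bullet> y"
    by (metis dot_lmul_matrix transpose_matrix_vector)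
next
  assume *: "\<forall>x y. x \<bullet> (A *v y) = (A *v x) \<bullet> y"
  have "transpose A *v x = A *v x" for x
    by (rule vector_eq_ldot[THEN iffD1])
      (metis * dot_lmul_matrix transpose_matrix_vector inner_commute)
  then show "transpose A = A"
    by (simp add: matrix_eq)
qed

lemma sym_pos_defD:
  assumes "sym_pos_def A"
  shows "transpose A = A" and "x \<noteq> 0 \<Longrightarrow> x \<bullet> (A *v x) > 0"
    and "x \<bullet> (A *v x) \<ge> 0" and "x \<bullet> (A *v x) = 0 \<longleftrightarrow> x = 0"
    and "x \<bullet> (A *v y) = (A *v x) \<bullet> y"
proof -
  show "transpose A = A" and pos: "x \<noteq> 0 \<Longrightarrow> x \<bullet> (A *v x) > 0" for x
    using assms by (auto simp: sym_pos_def_def)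
  then show "x \<bullet> (A *v y) = (A *v x) \<bullet> y"
    by (simp add: symmetric_matrix_iff)
  show "x \<bullet> (A *v x) \<ge> 0" "x \<bullet> (A *v x) = 0 \<longleftrightarrow> x = 0"
    using pos[of x] by (cases "x = 0"; auto)+
qed

text \<open>Definiteness makes the kernel trivial, which gives a left inverse; for a square matrix
  it is two-sided, so the choice in \<open>matrix_inv\<close> is well founded.\<close>

lemma sym_pos_def_inv:
  assumes "sym_pos_def A"
  shows "matrix_inv A ** A = mat 1" and "A ** matrix_inv A = mat 1"
proof -
  have "\<forall>x. A *v x = 0 \<longrightarrow> x = 0"
    using sym_pos_defD(4)[OF assms] by (metis inner_zero_right)
  then obtain C where "C ** A = mat 1"
    using matrix_left_invertible_ker by blast
  then have "C ** A = mat 1 \<and> A ** C = mat 1"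
    using matrix_left_right_inverse by blast
  then have "A ** matrix_inv A = mat 1 \<and> matrix_inv A ** A = mat 1"
    unfolding matrix_inv_def by (metis (mono_tags, lifting) someI)
  then show "matrix_inv A ** A = mat 1" "A ** matrix_inv A = mat 1" by auto
qed

section \<open>Spectral theorem for real symmetric matrices\<close>

text \<open>A first-order optimality condition without derivatives: for small positive
  \<open>t\<close> the linear term would dominate and make the expression negative.\<close>

lemma quadratic_nonneg_imp_linear_coeff_zero:
  fixes a b :: real
  assumes "\<And>t. 0 \<le> t\<^sup>2 * b - 2 * t * a" and "a \<ge> 0"
  shows "a = 0"
proof (rule ccontr)
  assume "a \<noteq> 0"
  \<comment> \<open>This choice gives \<open>t * b \<le> a\<close>, so the quadratic term is at most
    half of the linear one.\<close>
  define t where "t = a / (\<bar>b\<bar> + 1)"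
  have t: "t > 0" using \<open>a \<noteq> 0\<close> assms(2) by (simp add: t_def)
  have "t * b \<le> t * \<bar>b\<bar>" using t by (simp add: mult_left_mono)
  also have "\<dots> \<le> a" using assms(2) by (simp add: t_def field_simps)
  finally have "t * (t * b) \<le> t * a" using t by (simp add: mult_left_mono)
  moreover have "0 \<le> t * (t * b) - 2 * (t * a)"
    using assms(1)[of t] by (simp add: power2_eq_square algebra_simps)
  moreover have "t * a > 0" using t \<open>a \<noteq> 0\<close> assms(2) by simp
  ultimately show False by linarith
qed

text \<open>The form \<open>x \<bullet> (A *v x)\<close> attains its maximum on the compact unit
  sphere of \<open>U\<close>, and a maximizer is an eigenvector because no variation inside
  \<open>U\<close> can improve it.\<close>

lemma symmetric_eigenvector_exists:
  fixes A :: "real^'n^'n"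
  assumes sym: "transpose A = A" and U: "subspace U" and inv: "\<And>x. x \<in> U \<Longrightarrow> A *v x \<in> U"
    and nz: "\<exists>x\<in>U. x \<noteq> 0"
  shows "\<exists>e\<in>U. norm e = 1 \<and> A *v e = (e \<bullet> (A *v e)) *\<^sub>R e"
proof -
  let ?S = "U \<inter> sphere 0 1"
  from nz obtain x where x: "x \<in> U" "x \<noteq> 0" by blast
  then have "x /\<^sub>R norm x \<in> ?S" using U by (simp add: subspace_scale)
  then have ne: "?S \<noteq> {}" by blast
  have comp: "compact ?S"
    by (simp add: U closed_Int_compact closed_subspace)
  have cont: "continuous_on ?S (\<lambda>x. x \<bullet> (A *v x))"
    by (intro continuous_intros matrix_vector_mult_linear_continuous_on)
  from continuous_attains_sup[OF comp ne cont]
  obtain e where e: "e \<in> ?S" and max: "\<And>x. x \<in> ?S \<Longrightarrow> x \<bullet> (A *v x) \<le> e \<bullet> (A *v e)"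
    by blast
  define c where "c = e \<bullet> (A *v e)"
  \<comment> \<open>By homogeneity the bound on the sphere extends to all of \<open>U\<close>, so
    perturbed vectors need no normalization.\<close>
  have form: "x \<bullet> (A *v x) \<le> c * (x \<bullet> x)" if "x \<in> U" for x
  proof (cases "x = 0")
    case False
    then have "x /\<^sub>R norm x \<in> ?S" using that U by (simp add: subspace_scale)
    from max[OF this] have "(x \<bullet> (A *v x)) / (norm x)\<^sup>2 \<le> c"
      by (simp add: c_def matrix_vector_mult_scaleR power2_eq_square divide_simps)
    then show ?thesis using False by (simp add: divide_simps dot_square_norm)
  qed simp
  \<comment> \<open>The eigenvector defect serves as the direction of variation: along
    \<open>e - t *\<^sub>R r\<close> the linear coefficient is \<open>r \<bullet> r\<close>, which
    must therefore vanish.\<close>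
  define r where "r = c *\<^sub>R e - A *v e"
  have r: "r \<in> U" using e inv U by (auto simp: r_def subspace_scale subspace_diff)
  have ee: "e \<bullet> e = 1" using e by (simp add: dot_square_norm)
  have sm: "x \<bullet> (A *v y) = y \<bullet> (A *v x)" for x y
    using sym symmetric_matrix_iff by (metis inner_commute)
  have "r \<bullet> r = 0"
  proof (rule quadratic_nonneg_imp_linear_coeff_zero)
    fix t
    have "e - t *\<^sub>R r \<in> U" using e r U by (auto simp: subspace_scale subspace_diff)
    from form[OF this]
    have "0 \<le> c * ((e - t *\<^sub>R r) \<bullet> (e - t *\<^sub>R r)) - (e - t *\<^sub>R r) \<bullet> (A *v (e - t *\<^sub>R r))" by simp
    also have "\<dots> = t\<^sup>2 * (c * (r \<bullet> r) - r \<bullet> (A *v r)) - 2 * t * (r \<bullet> (c *\<^sub>R e - A *v e))"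
      unfolding matrix_vector_mult_diff_distrib matrix_vector_mult_scaleR
        inner_diff_left inner_diff_right inner_scaleR_left inner_scaleR_right ee sm[of e r]
        inner_commute[of e r] c_def[symmetric]
      by (simp add: algebra_simps power2_eq_square)
    finally show "0 \<le> t\<^sup>2 * (c * (r \<bullet> r) - r \<bullet> (A *v r)) - 2 * t * (r \<bullet> r)"
      by (simp add: r_def)
  qed simp
  then show ?thesis using e by (auto simp: r_def c_def)
qed

text \<open>Take an orthonormal set of eigenvectors of greatest cardinality. Its orthogonal
  complement is invariant under \<open>A\<close>; if nonzero, it would contain a further unit
  eigenvector.\<close>

lemma symmetric_matrix_spectral:
  fixes A :: "real^'n^'n"
  assumes sym: "transpose A = A"
  obtains E where "finite E" "pairwise orthogonal E" "\<And>e. e \<in> E \<Longrightarrow> norm e = 1"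
    "\<And>e. e \<in> E \<Longrightarrow> A *v e = (e \<bullet> (A *v e)) *\<^sub>R e" "\<And>x. x = (\<Sum>e\<in>E. (e \<bullet> x) *\<^sub>R e)"
proof -
  define P where "P E \<longleftrightarrow> pairwise orthogonal E \<and>
    (\<forall>e\<in>E. norm e = 1 \<and> A *v e = (e \<bullet> (A *v e)) *\<^sub>R e)" for E
  have ind: "independent E" if "P E" for E
    using that unfolding P_def by (intro pairwise_orthogonal_independent) auto
  have P0: "P {}" by (simp add: P_def)
  \<comment> \<open>Orthonormal sets are independent, so the dimension bounds their size and a
    largest one exists.\<close>
  have "card E \<le> CARD('n)" if "P E" for E
    using independent_bound[OF ind[OF that]] by simp
  then have "\<forall>E. P E \<longrightarrow> card E < Suc CARD('n)" by (simp add: less_Suc_eq_le)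
  from ex_has_greatest_nat[of P, OF P0 this]
  obtain E where E: "P E" and max: "\<And>E'. P E' \<Longrightarrow> card E' \<le> card E"
    by blast
  have fin: "finite E" using ind[OF E] by (rule independent_imp_finite)
  define U where "U = {x. \<forall>e\<in>E. orthogonal e x}"
  have U: "subspace U" unfolding U_def by (rule subspace_orthogonal_to_vectors)
  have inv: "A *v x \<in> U" if "x \<in> U" for x
    unfolding U_def
  proof safe
    fix e assume e: "e \<in> E"
    have "e \<bullet> (A *v x) = (A *v e) \<bullet> x" using sym symmetric_matrix_iff by blast
    also have "\<dots> = (e \<bullet> (A *v e)) * (e \<bullet> x)"
      using E e unfolding P_def by (metis inner_scaleR_left)
    also have "\<dots> = 0" using e that by (simp add: U_def orthogonal_def)
    finally show "orthogonal e (A *v x)" by (simp add: orthogonal_def)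
  qed
  have U0: "x = 0" if "x \<in> U" for x
  proof (rule ccontr)
    assume "x \<noteq> 0"
    then have "\<exists>x\<in>U. x \<noteq> 0" using that by blast
    with sym U inv have "\<exists>f\<in>U. norm f = 1 \<and> A *v f = (f \<bullet> (A *v f)) *\<^sub>R f"
      by (rule symmetric_eigenvector_exists)
    then obtain f where f: "f \<in> U" "norm f = 1" "A *v f = (f \<bullet> (A *v f)) *\<^sub>R f"
      by (elim bexE conjE)
    have "f \<notin> E" using f(1,2) by (auto simp: U_def orthogonal_def)
    moreover have "P (insert f E)"
      using f E by (auto simp: P_def U_def pairwise_insert orthogonal_commute)
    ultimately show False using max[of "insert f E"] fin by simp
  qed
  \<comment> \<open>The defect of the Fourier expansion is orthogonal to every member of
    \<open>E\<close>, hence lies in the trivial space \<open>U\<close>.\<close>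
  have exp: "x = (\<Sum>e\<in>E. (e \<bullet> x) *\<^sub>R e)" for x
  proof -
    have "x - (\<Sum>e\<in>E. (e \<bullet> x) *\<^sub>R e) \<in> U"
      unfolding U_def
    proof safe
      fix e assume e: "e \<in> E"
      have "e \<bullet> (\<Sum>f\<in>E. (f \<bullet> x) *\<^sub>R f) = (\<Sum>f\<in>E. if f = e then e \<bullet> x else 0)"
        unfolding inner_sum_right
        using e E by (intro sum.cong) (auto simp: P_def pairwise_def orthogonal_def dot_square_norm)
      then show "orthogonal e (x - (\<Sum>e\<in>E. (e \<bullet> x) *\<^sub>R e))"
        using e fin by (simp add: orthogonal_def inner_diff_right)
    qed
    from U0[OF this] show ?thesis by simp
  qed
  show ?thesis
    by (rule that[OF fin _ _ _ exp]) (use E in \<open>auto simp: P_def\<close>)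
qed

section \<open>Existence and uniqueness of the positive definite square root\<close>

text \<open>The root keeps the eigenvectors of \<open>A\<close> and replaces each eigenvalue by its
  square root.\<close>

lemma sym_pos_def_sqrt_exists:
  fixes A :: "real^'n^'n"
  assumes A: "sym_pos_def A"
  shows "\<exists>S. sym_pos_def S \<and> S ** S = A"
proof -
  obtain E where E: "finite E" "pairwise orthogonal E" "\<And>e. e \<in> E \<Longrightarrow> norm e = 1"
    "\<And>e. e \<in> E \<Longrightarrow> A *v e = (e \<bullet> (A *v e)) *\<^sub>R e" and exp: "\<And>x. x = (\<Sum>e\<in>E. (e \<bullet> x) *\<^sub>R e)"
    by (rule symmetric_matrix_spectral[OF sym_pos_defD(1)[OF A]]) (rule that)
  define c where "c e = sqrt (e \<bullet> (A *v e))" for e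
  have cpos: "c e > 0" if "e \<in> E" for e
    unfolding c_def using E(3)[OF that] sym_pos_defD(2)[OF A, of e] by (cases "e = 0") auto
  define f where "f x = (\<Sum>e\<in>E. (c e * (e \<bullet> x)) *\<^sub>R e)" for x
  have lin: "linear f"
    unfolding f_def by (intro linearI)
      (simp_all add: inner_add_right sum.distrib[symmetric] algebra_simps scaleR_sum_right)
  define S where "S = matrix f"
  have S: "S *v x = f x" for x
    using matrix_works[of f x] lin by (simp add: S_def linear_matrix_vector_mul_eq)
  have fe: "f e = c e *\<^sub>R e" if "e \<in> E" for e
  proof -
    have "f e = (\<Sum>g\<in>E. if g = e then c e *\<^sub>R e else 0)"
      unfolding f_def using that E
      by (intro sum.cong) (auto simp: pairwise_def orthogonal_def dot_square_norm)
    then show ?thesis using that E(1) by simp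
  qed
  have "x \<bullet> f y = f x \<bullet> y" for x y
    by (simp add: f_def inner_sum_left inner_sum_right inner_commute algebra_simps)
  then have "transpose S = S" by (simp add: symmetric_matrix_iff S)
  moreover have "x \<bullet> (S *v x) > 0" if "x \<noteq> 0" for x
  proof -
    have "\<exists>e\<in>E. e \<bullet> x \<noteq> 0" using exp[of x] that
      by (metis (no_types, lifting) scaleR_zero_left sum.neutral)
    \<comment> \<open>All terms are nonnegative, so one strictly positive term suffices; the choice
      operator names an index with a nonzero coordinate.\<close>
    then have "(\<Sum>e\<in>E. c e * (e \<bullet> x)\<^sup>2) > 0"
      by (intro sum_pos2[of _ "SOME e. e \<in> E \<and> e \<bullet> x \<noteq> 0"])
        (auto intro!: E(1) mult_pos_pos mult_nonneg_nonneg simp: less_imp_le[OF cpos] cpos, (metis (mono_tags, lifting) someI_ex cpos)+)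
    then show ?thesis
      by (simp add: S f_def inner_sum_right power2_eq_square inner_commute algebra_simps)
  qed
  moreover have "S ** S = A"
  proof -
    have "(S ** S) *v x = A *v x" for x
    proof -
      have "(S ** S) *v x = f (f x)" by (simp add: S matrix_vector_mul_assoc[symmetric])
      also have "\<dots> = (\<Sum>e\<in>E. (c e * (e \<bullet> x)) *\<^sub>R f e)"
        by (subst (2) f_def) (simp add: linear_sum[OF lin] linear_scale[OF lin])
      also have "\<dots> = (\<Sum>e\<in>E. (e \<bullet> x) *\<^sub>R (A *v e))"
      proof (intro sum.cong refl)
        fix e assume e: "e \<in> E"
        have "c e * c e = e \<bullet> (A *v e)"
          unfolding c_def using sym_pos_defD(3)[OF A] by simp
        then show "(c e * (e \<bullet> x)) *\<^sub>R f e = (e \<bullet> x) *\<^sub>R (A *v e)"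
          using fe[OF e] E(4)[OF e] by (metis mult.commute mult.left_commute scaleR_scaleR)
      qed
      also have "\<dots> = A *v (\<Sum>e\<in>E. (e \<bullet> x) *\<^sub>R e)"
        by (simp add: linear_sum[OF matrix_vector_mul_linear] matrix_vector_mult_scaleR)
      finally show ?thesis using exp[of x, symmetric] by simp
    qed
    then show ?thesis by (simp add: matrix_eq)
  qed
  ultimately show ?thesis unfolding sym_pos_def_def by blast
qed

text \<open>A positive definite root \<open>S\<close> of \<open>A\<close> must act on an eigenvector of \<open>A\<close> with eigenvalue \<open>c\<^sup>2\<close>
  as multiplication by \<open>c\<close>, since \<open>S + c\<close> is injective and \<open>(S + c) (S - c)\<close> kills the vector.\<close>

lemma sym_pos_def_sqrt_unique:
  fixes A :: "real^'n^'n"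
  assumes A: "sym_pos_def A" and S: "sym_pos_def S" "S ** S = A" and R: "sym_pos_def R" "R ** R = A"
  shows "S = R"
proof -
  obtain E where "finite E" "pairwise orthogonal E" "\<And>e. e \<in> E \<Longrightarrow> norm e = 1"
    and E: "\<And>e. e \<in> E \<Longrightarrow> A *v e = (e \<bullet> (A *v e)) *\<^sub>R e"
    and exp: "\<And>x. x = (\<Sum>e\<in>E. (e \<bullet> x) *\<^sub>R e)"
    by (rule symmetric_matrix_spectral[OF sym_pos_defD(1)[OF A]]) (rule that)
  define c where "c e = sqrt (e \<bullet> (A *v e))" for e
  have c0: "c e \<ge> 0" and cc: "c e * c e = e \<bullet> (A *v e)" for e
    unfolding c_def using sym_pos_defD(3)[OF A] by simp_all
  have root: "Q *v e = c e *\<^sub>R e" if Q: "sym_pos_def Q" "Q ** Q = A" and e: "e \<in> E" for Q e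
  proof -
    let ?w = "Q *v e - c e *\<^sub>R e"
    have "Q *v ?w + c e *\<^sub>R ?w = A *v e - (c e * c e) *\<^sub>R e"
      using Q(2) by (simp add: matrix_vector_mult_diff_distrib matrix_vector_mult_scaleR
          matrix_vector_mul_assoc scaleR_diff_right)
    also have "\<dots> = 0" unfolding cc E[OF e, symmetric] by simp
    finally have "?w \<bullet> (Q *v ?w + c e *\<^sub>R ?w) = 0" by simp
    then have "?w \<bullet> (Q *v ?w) + c e * (?w \<bullet> ?w) = 0"
      by (simp only: inner_add_right inner_scaleR_right)
    moreover have "c e * (?w \<bullet> ?w) \<ge> 0" using c0 by simp
    ultimately have "?w \<bullet> (Q *v ?w) = 0" using sym_pos_defD(3)[OF Q(1), of ?w] by linarith
    then show ?thesis using sym_pos_defD(4)[OF Q(1), of ?w] by simp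
  qed
  have "S *v x = R *v x" for x
  proof -
    have "S *v (\<Sum>e\<in>E. (e \<bullet> x) *\<^sub>R e) = R *v (\<Sum>e\<in>E. (e \<bullet> x) *\<^sub>R e)"
      unfolding linear_sum[OF matrix_vector_mul_linear] matrix_vector_mult_scaleR
      by (intro sum.cong refl) (simp only: root[OF S] root[OF R])
    then show ?thesis using exp[of x, symmetric] by simp
  qed
  then show ?thesis by (simp add: matrix_eq)
qed

lemma matrix_sqrt:
  assumes "sym_pos_def A"
  shows "sym_pos_def (matrix_sqrt A)" and "matrix_sqrt A ** matrix_sqrt A = A"
proof -
  have "\<exists>!S. sym_pos_def S \<and> S ** S = A"
    using sym_pos_def_sqrt_exists[OF assms] sym_pos_def_sqrt_unique[OF assms] by blast
  from theI'[OF this] have "sym_pos_def (matrix_sqrt A) \<and> matrix_sqrt A ** matrix_sqrt A = A"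
    unfolding matrix_sqrt_def .
  then show "sym_pos_def (matrix_sqrt A)" "matrix_sqrt A ** matrix_sqrt A = A"
    by (rule conjunct1, rule conjunct2)
qed

lemma norm_matrix_sqrt_mult:
  assumes "sym_pos_def A"
  shows "(norm (matrix_sqrt A *v x))\<^sup>2 = x \<bullet> (A *v x)"
proof -
  let ?S = "matrix_sqrt A"
  have "x \<bullet> (A *v x) = x \<bullet> (?S *v (?S *v x))"
    by (simp add: matrix_vector_mul_assoc matrix_sqrt(2)[OF assms])
  also have "\<dots> = (?S *v x) \<bullet> (?S *v x)"
    by (rule sym_pos_defD(5)[OF matrix_sqrt(1)[OF assms]])
  finally show ?thesis by (simp add: dot_square_norm)
qed

section \<open>Generalized singular pairs\<close>

lemma outer_prod_component: "outer_prod u v $ i $ j = u $ i * v $ j"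
  by (simp add: outer_prod_def columnvector_def rowvector_def matrix_matrix_mult_def)

lemma outer_prod_mult_vec: "outer_prod u v *v y = (v \<bullet> y) *\<^sub>R u"
  by (simp add: vec_eq_iff matrix_vector_mult_def outer_prod_component inner_vec_def
      sum_distrib_left mult_ac)

lemma sum_matrix_vector_mult: "sum M I *v y = (\<Sum>i\<in>I. M i *v y)"
  for M :: "'i \<Rightarrow> real^'n^'m"
  by (induction I rule: infinite_finite_induct) (simp_all add: matrix_vector_mult_add_rdistrib)

text \<open>Equality case of the Cauchy--Schwarz inequality for the form of \<open>A\<close>, tested against the
  unconstrained optimum \<open>A\<inverse> y\<close>.\<close>

lemma rayleigh_optimum_parallel:
  assumes A: "sym_pos_def A" and u: "u \<noteq> 0" and h: "A *v h = y"
    and opt: "(h \<bullet> y)\<^sup>2 * (u \<bullet> (A *v u)) \<le> (u \<bullet> y)\<^sup>2 * (h \<bullet> (A *v h))"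
  shows "y = ((u \<bullet> y) / (u \<bullet> (A *v u))) *\<^sub>R (A *v u)"
proof -
  define a a0 c where "a = h \<bullet> y" and "a0 = u \<bullet> (A *v u)" and "c = u \<bullet> y"
  have a0: "a0 > 0" using sym_pos_defD(2)[OF A u] by (simp add: a0_def)
  have a: "a \<ge> 0" using sym_pos_defD(3)[OF A, of h] h by (simp add: a_def)
  have opt': "a * (a * a0) \<le> a * c\<^sup>2"
    using opt h by (simp add: a_def a0_def c_def power2_eq_square algebra_simps)
  \<comment> \<open>If \<open>a = 0\<close> the inequality is trivial; otherwise the common factor
    \<open>a\<close> of \<open>opt'\<close> cancels.\<close>
  have le: "a * a0 \<le> c\<^sup>2"
  proof (cases "a = 0")
    case False
    then show ?thesis using opt' a by simp
  qed simp
  \<comment> \<open>\<open>w\<close> is the residual of \<open>h\<close> after projection onto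
    \<open>u\<close> in the form of \<open>A\<close>. Its form value is the Cauchy--Schwarz deficit,
    which optimality makes nonpositive.\<close>
  define w where "w = h - (c / a0) *\<^sub>R u"
  have uAh: "u \<bullet> (A *v h) = c" "h \<bullet> (A *v u) = c"
    using h sym_pos_defD(5)[OF A, of h u] by (simp_all add: c_def inner_commute)
  have "w \<bullet> (A *v w) = a - c\<^sup>2 / a0"
    unfolding w_def matrix_vector_mult_diff_distrib matrix_vector_mult_scaleR
      inner_diff_left inner_diff_right inner_scaleR_left inner_scaleR_right uAh a0_def[symmetric]
    using a0 by (simp add: h a_def[symmetric] power2_eq_square field_simps)
  also have "\<dots> \<le> 0" using le a0 by (simp add: field_simps)
  finally have "w = 0" using sym_pos_defD(3,4)[OF A, of w] by simp
  then have "h = (c / a0) *\<^sub>R u" by (simp add: w_def)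
  then show ?thesis using h by (auto simp: a0_def c_def matrix_vector_mult_scaleR)
qed

text \<open>Gram--Schmidt for the form of \<open>B\<close>: subtracting the projections onto the
  \<open>v k\<close> leaves a vector orthogonal to each of them.\<close>

lemma form_orthogonal_residual:
  assumes B: "sym_pos_def B" and fin: "finite I" and nz: "\<And>k. k \<in> I \<Longrightarrow> v k \<noteq> 0"
    and orth: "\<And>k l. k \<in> I \<Longrightarrow> l \<in> I \<Longrightarrow> k \<noteq> l \<Longrightarrow> v k \<bullet> (B *v v l) = 0" and l: "l \<in> I"
  shows "(x - (\<Sum>k\<in>I. (x \<bullet> (B *v v k) / (v k \<bullet> (B *v v k))) *\<^sub>R v k)) \<bullet> (B *v v l) = 0"
proof -
  have "(\<Sum>k\<in>I. (x \<bullet> (B *v v k) / (v k \<bullet> (B *v v k))) * (v k \<bullet> (B *v v l)))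
      = (\<Sum>k\<in>I. if k = l then x \<bullet> (B *v v l) else 0)"
    using orth l nz sym_pos_defD(4)[OF B] by (intro sum.cong refl) auto
  also have "\<dots> = x \<bullet> (B *v v l)" using fin l by simp
  finally show ?thesis by (simp add: inner_diff_left inner_sum_left)
qed

text \<open>The square root of \<open>A\<close> turns orthogonality for the form into Euclidean
  orthogonality. The images are independent and lie in the range of \<open>?S ** M\<close>, whose
  rank is at most that of \<open>M\<close>.\<close>

lemma form_orthogonal_card_le_rank:
  fixes M :: "real^'n^'m" and u :: "'i \<Rightarrow> real^'m"
  assumes A: "sym_pos_def A" and fin: "finite I"
    and nz: "\<And>k. k \<in> I \<Longrightarrow> u k \<noteq> 0" and rng: "\<And>k. k \<in> I \<Longrightarrow> u k \<in> range ((*v) M)"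
    and orth: "\<And>k l. k \<in> I \<Longrightarrow> l \<in> I \<Longrightarrow> k \<noteq> l \<Longrightarrow> u k \<bullet> (A *v u l) = 0"
  shows "card I \<le> rank M"
proof -
  let ?S = "matrix_sqrt A"
  have sq: "(?S *v x) \<bullet> (?S *v y) = x \<bullet> (A *v y)" for x y
    using sym_pos_defD(5)[OF matrix_sqrt(1)[OF A], of x "?S *v y"]
    by (simp add: matrix_vector_mul_assoc matrix_sqrt(2)[OF A])
  let ?f = "\<lambda>k. ?S *v u k"
  have nz': "?f k \<noteq> 0" if "k \<in> I" for k
  proof
    assume "?f k = 0"
    then have "u k \<bullet> (A *v u k) = 0" by (simp flip: sq)
    then show False using nz[OF that] sym_pos_defD(4)[OF A] by blast
  qed
  \<comment> \<open>The family is indexed, so counting indices requires that distinct indices give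
    distinct vectors.\<close>
  have inj: "inj_on ?f I"
  proof (rule inj_onI, rule ccontr)
    fix k l assume kl: "k \<in> I" "l \<in> I" "?f k = ?f l" "k \<noteq> l"
    then have "?f k \<bullet> ?f k = 0" using orth[of k l] sq[of "u k" "u l"] by simp
    then show False using nz'[OF kl(1)] by simp
  qed
  have "independent (?f ` I)"
  proof (rule pairwise_orthogonal_independent)
    show "pairwise orthogonal (?f ` I)"
      unfolding pairwise_def orthogonal_def by (auto simp: sq intro!: orth)
    show "0 \<notin> ?f ` I"
    proof
      assume "0 \<in> ?f ` I"
      then obtain k where "0 = ?f k" "k \<in> I" by (rule imageE)
      then show False using nz'[of k] by simp
    qed
  qed
  moreover have "?f ` I \<subseteq> range ((*v) (?S ** M))"
  proof safe
    fix k assume "k \<in> I"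
    then obtain x where "u k = M *v x" using rng by blast
    then show "?f k \<in> range ((*v) (?S ** M))" by (auto simp: matrix_vector_mul_assoc)
  qed
  ultimately have "card (?f ` I) \<le> dim (range ((*v) (?S ** M)))"
    by (rule independent_card_le_dim[rotated])
  also have "\<dots> = rank (?S ** M)" by (rule rank_dim_range[symmetric])
  also have "\<dots> \<le> rank M" by (rule rank_mul_le_right)
  finally show ?thesis by (simp add: card_image[OF inj])
qed

lemma matrix_vector_inner: "u \<bullet> (D *v v) = v \<bullet> (transpose D *v u)"
  for D :: "real^'n^'m"
  by (metis dot_lmul_matrix inner_commute transpose_matrix_vector)

text \<open>Successive maximizers of \<open>(u' D v)\<^sup>2 / ((u' A u) (v' B v))\<close> are, up to scaling, the
  singular vectors of \<open>A\<^sup>-\<^sup>1\<^sup>/\<^sup>2 D B\<^sup>-\<^sup>1\<^sup>/\<^sup>2\<close> pulled pull_u by the square roots: the stationarity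
  equations \<open>D v\<^sub>j = (\<delta>\<^sub>j / a\<^sub>j) A u\<^sub>j\<close> and \<open>D' u\<^sub>j = (\<delta>\<^sub>j / b\<^sub>j) B v\<^sub>j\<close> turn the constraints of
  the later steps into orthogonality for the forms of \<open>A\<close> and \<open>B\<close>.\<close>

lemma singular_sequence:
  fixes A :: "real^'p^'p" and B :: "real^'q^'q" and D :: "real^'q^'p"
    and us :: "nat \<Rightarrow> real^'p" and vs :: "nat \<Rightarrow> real^'q" and \<beta> :: real
  defines "F \<equiv> \<lambda>j u v. \<forall>k\<in>{1..<j}.
      (u \<bullet> (A *v us k)) * (vs k \<bullet> (B *v vs k)) + \<beta> * (u \<bullet> (D *v vs k)) * (us k \<bullet> (D *v vs k)) = 0 \<and>
      (v \<bullet> (B *v vs k)) * (us k \<bullet> (A *v us k)) + \<beta> * (us k \<bullet> (D *v v)) * (us k \<bullet> (D *v vs k)) = 0"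
  assumes A: "sym_pos_def A" and B: "sym_pos_def B" and \<beta>: "\<beta> \<ge> 0" and d: "d = rank D"
    and unz: "\<And>j. j \<in> {1..d} \<Longrightarrow> us j \<noteq> 0" and vnz: "\<And>j. j \<in> {1..d} \<Longrightarrow> vs j \<noteq> 0"
    and feas: "\<And>j. j \<in> {1..d} \<Longrightarrow> F j (us j) (vs j)"
    and opt: "\<And>j u v. j \<in> {1..d} \<Longrightarrow> norm u = 1 \<Longrightarrow> norm v = 1 \<Longrightarrow> F j u v \<Longrightarrow>
      (u \<bullet> (D *v v))\<^sup>2 * ((us j \<bullet> (A *v us j)) * (vs j \<bullet> (B *v vs j)))
      \<le> (us j \<bullet> (D *v vs j))\<^sup>2 * ((u \<bullet> (A *v u)) * (v \<bullet> (B *v v)))"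
  shows "\<And>j. j \<in> {1..d} \<Longrightarrow> us j \<bullet> (D *v vs j) \<noteq> 0"
    and "(\<Sum>j=1..d. ((us j \<bullet> (D *v vs j)) / ((us j \<bullet> (A *v us j)) * (vs j \<bullet> (B *v vs j))))
           *\<^sub>R outer_prod (us j) (vs j)) = matrix_inv A ** D ** matrix_inv B"
proof -
  define a b \<delta> where "a j = us j \<bullet> (A *v us j)" and "b j = vs j \<bullet> (B *v vs j)"
    and "\<delta> j = us j \<bullet> (D *v vs j)" for j
  have apos: "a j > 0" if "j \<in> {1..d}" for j
    using sym_pos_defD(2)[OF A unz[OF that]] by (simp add: a_def)
  have bpos: "b j > 0" if "j \<in> {1..d}" for j
    using sym_pos_defD(2)[OF B vnz[OF that]] by (simp add: b_def)
  have Ainv: "A *v (matrix_inv A *v x) = x" for x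
    by (simp add: matrix_vector_mul_assoc sym_pos_def_inv[OF A])
  have Binv: "B *v (matrix_inv B *v x) = x" for x
    by (simp add: matrix_vector_mul_assoc sym_pos_def_inv[OF B])
  have symA: "x \<bullet> (A *v y) = y \<bullet> (A *v x)" for x y
    using sym_pos_defD(5)[OF A, of x y] by (simp add: inner_commute)
  have symB: "x \<bullet> (B *v y) = y \<bullet> (B *v x)" for x y
    using sym_pos_defD(5)[OF B, of x y] by (simp add: inner_commute)
  \<comment> \<open>The induction invariant: both stationarity equations, a nonzero singular value,
    and orthogonality to all earlier pairs.\<close>
  define Q where "Q j \<longleftrightarrow> D *v vs j = (\<delta> j / a j) *\<^sub>R (A *v us j) \<and>
      transpose D *v us j = (\<delta> j / b j) *\<^sub>R (B *v vs j) \<and> \<delta> j \<noteq> 0 \<and>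
      (\<forall>k\<in>{1..<j}. us j \<bullet> (A *v us k) = 0 \<and> vs j \<bullet> (B *v vs k) = 0)" for j
  have QD: "u \<bullet> (D *v vs j) = (\<delta> j / a j) * (u \<bullet> (A *v us j))" if "Q j" for j u
    using that unfolding Q_def by (metis inner_scaleR_right)
  have QD': "us j \<bullet> (D *v v) = (\<delta> j / b j) * (v \<bullet> (B *v vs j))" if "Q j" for j v
    using that unfolding Q_def matrix_vector_inner[of "us j"] by (metis inner_scaleR_right)
  \<comment> \<open>\<open>Q\<close> compares an index only with smaller ones; symmetry of the forms
    gives orthogonality for every pair of distinct indices.\<close>
  have orthv: "vs k \<bullet> (B *v vs l) = 0" and orthu: "us k \<bullet> (A *v us l) = 0"
    if Qm: "\<And>i. i \<in> {1..<m} \<Longrightarrow> Q i" and kl: "k \<in> {1..<m}" "l \<in> {1..<m}" "k \<noteq> l" for k l m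
  proof -
    consider "k \<in> {1..<l}" | "l \<in> {1..<k}" using kl by fastforce
    then have "vs k \<bullet> (B *v vs l) = 0 \<and> us k \<bullet> (A *v us l) = 0"
    proof cases
      case 1
      then show ?thesis using Qm[OF kl(2)] symA[of "us k"] symB[of "vs k"] by (simp add: Q_def)
    next
      case 2
      then show ?thesis using Qm[OF kl(1)] by (simp add: Q_def)
    qed
    then show "vs k \<bullet> (B *v vs l) = 0" "us k \<bullet> (A *v us l) = 0" by simp_all
  qed
  \<comment> \<open>Stationarity of earlier pairs makes the constraint spaces invariant:
    \<open>matrix_inv A ** D\<close> carries admissible \<open>v\<close> to admissible
    \<open>u\<close>, and \<open>pull_v\<close> does the converse. Hence the unconstrained optima
    below remain admissible competitors.\<close>
  have pull_u: "(matrix_inv A *v (D *v v)) \<bullet> (A *v us k) = 0"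
    if "Q k" "v \<bullet> (B *v vs k) = 0" for k v
  proof -
    have "(matrix_inv A *v (D *v v)) \<bullet> (A *v us k) = us k \<bullet> (D *v v)"
      by (subst symA) (simp add: Ainv)
    then show ?thesis using QD'[OF that(1)] that(2) by simp
  qed
  have pull_v: "(matrix_inv B *v (transpose D *v u)) \<bullet> (B *v vs k) = 0"
    if "Q k" "u \<bullet> (A *v us k) = 0" for k u
  proof -
    have "(matrix_inv B *v (transpose D *v u)) \<bullet> (B *v vs k) = u \<bullet> (D *v vs k)"
      by (subst symB) (simp only: Binv matrix_vector_inner[of u])
    then show ?thesis using QD[OF that(1)] that(2) by simp
  qed
  have step: "Q j" if j: "j \<in> {1..d}" and IH: "\<And>k. k \<in> {1..<j} \<Longrightarrow> Q k" for j
  proof -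
    have kd: "k \<in> {1..d}" if "k \<in> {1..<j}" for k using that j by auto
    have F_iff: "F j u v \<longleftrightarrow> (\<forall>k\<in>{1..<j}. u \<bullet> (A *v us k) = 0 \<and> v \<bullet> (B *v vs k) = 0)" for u v
      unfolding F_def
    proof (intro ball_cong refl)
      fix k assume k: "k \<in> {1..<j}"
      have pos: "b k + \<beta> * (\<delta> k)\<^sup>2 / a k > 0" "a k + \<beta> * (\<delta> k)\<^sup>2 / b k > 0"
        using apos[OF kd[OF k]] bpos[OF kd[OF k]] \<beta> by (simp_all add: add_pos_nonneg)
      have "(u \<bullet> (A *v us k)) * b k + \<beta> * (u \<bullet> (D *v vs k)) * \<delta> k
          = (u \<bullet> (A *v us k)) * (b k + \<beta> * (\<delta> k)\<^sup>2 / a k)"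
        unfolding QD[OF IH[OF k]] by (simp add: power2_eq_square algebra_simps)
      moreover have "(v \<bullet> (B *v vs k)) * a k + \<beta> * (us k \<bullet> (D *v v)) * \<delta> k
          = (v \<bullet> (B *v vs k)) * (a k + \<beta> * (\<delta> k)\<^sup>2 / b k)"
        unfolding QD'[OF IH[OF k]] by (simp add: power2_eq_square algebra_simps)
      ultimately show "((u \<bullet> (A *v us k)) * (vs k \<bullet> (B *v vs k))
            + \<beta> * (u \<bullet> (D *v vs k)) * (us k \<bullet> (D *v vs k)) = 0 \<and>
          (v \<bullet> (B *v vs k)) * (us k \<bullet> (A *v us k))
            + \<beta> * (us k \<bullet> (D *v v)) * (us k \<bullet> (D *v vs k)) = 0)
          = (u \<bullet> (A *v us k) = 0 \<and> v \<bullet> (B *v vs k) = 0)"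
        unfolding a_def[symmetric] b_def[symmetric] \<delta>_def[symmetric] using pos by simp
    qed
    \<comment> \<open>Both sides scale by the same positive factor, so the unit norm restriction
      disappears; zero vectors satisfy the inequality trivially.\<close>
    have opt': "(u \<bullet> (D *v v))\<^sup>2 * (a j * b j) \<le> (\<delta> j)\<^sup>2 * ((u \<bullet> (A *v u)) * (v \<bullet> (B *v v)))"
      if orth: "\<And>k. k \<in> {1..<j} \<Longrightarrow> u \<bullet> (A *v us k) = 0"
        "\<And>k. k \<in> {1..<j} \<Longrightarrow> v \<bullet> (B *v vs k) = 0" for u v
    proof (cases "u = 0 \<or> v = 0")
      case False
      define s t where "s = inverse (norm u)" and "t = inverse (norm v)"
      have st: "s > 0" "t > 0" using False by (simp_all add: s_def t_def)
      have "norm (s *\<^sub>R u) = 1" "norm (t *\<^sub>R v) = 1" using False by (simp_all add: s_def t_def)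
      moreover have "F j (s *\<^sub>R u) (t *\<^sub>R v)"
        unfolding F_iff using orth by simp
      ultimately have "((s *\<^sub>R u) \<bullet> (D *v (t *\<^sub>R v)))\<^sup>2 * (a j * b j)
          \<le> (\<delta> j)\<^sup>2 * (((s *\<^sub>R u) \<bullet> (A *v (s *\<^sub>R u))) * ((t *\<^sub>R v) \<bullet> (B *v (t *\<^sub>R v))))"
        unfolding a_def b_def \<delta>_def by (rule opt[OF j])
      then have "(s\<^sup>2 * t\<^sup>2) * ((u \<bullet> (D *v v))\<^sup>2 * (a j * b j))
          \<le> (s\<^sup>2 * t\<^sup>2) * ((\<delta> j)\<^sup>2 * ((u \<bullet> (A *v u)) * (v \<bullet> (B *v v))))"
        by (simp add: matrix_vector_mult_scaleR power2_eq_square algebra_simps)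
      then show ?thesis using st by simp
    qed auto
    have oj: "us j \<bullet> (A *v us k) = 0" "vs j \<bullet> (B *v vs k) = 0" if "k \<in> {1..<j}" for k
      using feas[OF j] that unfolding F_iff by auto
    \<comment> \<open>Keep \<open>vs j\<close> fixed and compare with the best left partner
      \<open>matrix_inv A *v (D *v vs j)\<close>; the equality case forces \<open>us j\<close> to be
      parallel to it unless \<open>D *v vs j\<close> vanishes.\<close>
    have 1: "D *v vs j = (\<delta> j / a j) *\<^sub>R (A *v us j)"
    proof -
      let ?h = "matrix_inv A *v (D *v vs j)"
      have "(?h \<bullet> (D *v vs j))\<^sup>2 * (a j * b j) \<le> (\<delta> j)\<^sup>2 * ((?h \<bullet> (A *v ?h)) * (vs j \<bullet> (B *v vs j)))"
        by (rule opt') (simp_all add: pull_u IH oj)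
      then have "(?h \<bullet> (D *v vs j))\<^sup>2 * a j * b j \<le> (\<delta> j)\<^sup>2 * (?h \<bullet> (A *v ?h)) * b j"
        by (simp add: b_def mult.assoc)
      then have "(?h \<bullet> (D *v vs j))\<^sup>2 * a j \<le> (\<delta> j)\<^sup>2 * (?h \<bullet> (A *v ?h))"
        using bpos[OF j] by simp
      then show ?thesis
        unfolding \<delta>_def a_def by (intro rayleigh_optimum_parallel[OF A unz[OF j] Ainv])
    qed
    have 2: "transpose D *v us j = (\<delta> j / b j) *\<^sub>R (B *v vs j)"
    proof -
      let ?y = "transpose D *v us j"
      let ?h = "matrix_inv B *v ?y"
      have "(us j \<bullet> (D *v ?h))\<^sup>2 * (a j * b j) \<le> (\<delta> j)\<^sup>2 * ((us j \<bullet> (A *v us j)) * (?h \<bullet> (B *v ?h)))"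
        by (rule opt') (simp_all only: pull_v IH oj)
      then have "(us j \<bullet> (D *v ?h))\<^sup>2 * b j * a j \<le> (\<delta> j)\<^sup>2 * (?h \<bullet> (B *v ?h)) * a j"
        by (simp only: a_def mult_ac)
      then have "(us j \<bullet> (D *v ?h))\<^sup>2 * b j \<le> (\<delta> j)\<^sup>2 * (?h \<bullet> (B *v ?h))"
        using apos[OF j] by (simp only: mult_le_cancel_right_pos)
      then show ?thesis
        unfolding \<delta>_def b_def matrix_vector_inner[of "us j"]
        by (intro rayleigh_optimum_parallel[OF B vnz[OF j] Binv])
    qed
    \<comment> \<open>A zero optimal value would make \<open>D\<close> vanish on the whole
      \<open>B\<close>-complement of the earlier \<open>vs k\<close>, leaving rank at most
      \<open>j - 1\<close>, which is less than \<open>d\<close>.\<close>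
    have 3: "\<delta> j \<noteq> 0"
    proof
      assume 0: "\<delta> j = 0"
      have ker: "D *v v = 0" if "\<And>k. k \<in> {1..<j} \<Longrightarrow> v \<bullet> (B *v vs k) = 0" for v
      proof -
        let ?h = "matrix_inv A *v (D *v v)"
        have "(?h \<bullet> (D *v v))\<^sup>2 * (a j * b j) \<le> (\<delta> j)\<^sup>2 * ((?h \<bullet> (A *v ?h)) * (v \<bullet> (B *v v)))"
          by (rule opt') (simp_all add: pull_u IH that)
        then have "?h \<bullet> (D *v v) = 0"
          using 0 apos[OF j] bpos[OF j] by (simp add: mult_le_0_iff)
        then have "?h \<bullet> (A *v ?h) = 0" by (simp add: Ainv)
        then have "?h = 0" using sym_pos_defD(4)[OF A] by blast
        then show ?thesis using Ainv[of "D *v v"] by simp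
      qed
      have "range ((*v) D) \<subseteq> span ((\<lambda>k. D *v vs k) ` {1..<j})"
      proof safe
        fix v
        let ?w = "\<Sum>k\<in>{1..<j}. (v \<bullet> (B *v vs k) / (vs k \<bullet> (B *v vs k))) *\<^sub>R vs k"
        have "D *v (v - ?w) = 0"
          by (intro ker form_orthogonal_residual[OF B]) (use orthv[of j] IH vnz kd in auto)
        then have "D *v v = D *v ?w" by (simp add: matrix_vector_mult_diff_distrib)
        also have "\<dots> = (\<Sum>k\<in>{1..<j}. (v \<bullet> (B *v vs k) / (vs k \<bullet> (B *v vs k))) *\<^sub>R (D *v vs k))"
          by (simp add: linear_sum[OF matrix_vector_mul_linear] matrix_vector_mult_scaleR)
        also have "\<dots> \<in> span ((\<lambda>k. D *v vs k) ` {1..<j})"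
          by (intro span_sum span_scale span_base imageI)
        finally show "D *v v \<in> span ((\<lambda>k. D *v vs k) ` {1..<j})" .
      qed
      then have "dim (range ((*v) D)) \<le> card ((\<lambda>k. D *v vs k) ` {1..<j})"
        by (intro dim_le_card) auto
      also have "\<dots> \<le> card {1..<j}" by (rule card_image_le) simp
      also have "\<dots> < d" using j by auto
      finally show False using d by (simp add: rank_dim_range)
    qed
    show "Q j" unfolding Q_def using 1 2 3 oj by blast
  qed
  have Q: "Q j" if "j \<in> {1..d}" for j
    using that
  proof (induction j rule: less_induct)
    case (less j)
    show ?case by (rule step[OF less.prems]) (use less in auto)
  qed
  show "us j \<bullet> (D *v vs j) \<noteq> 0" if "j \<in> {1..d}" for j
    using Q[OF that] by (simp add: Q_def \<delta>_def)
  have Q': "Q i" if "i \<in> {1..<Suc d}" for i using Q that by (simp add: atLeastLessThanSuc_atLeastAtMost)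
  \<comment> \<open>After \<open>d\<close> steps nothing is left: a nonzero \<open>D *v w\<close>
    would add one more \<open>A\<close>-orthogonal vector to the \<open>d\<close> vectors
    \<open>us k\<close>, all in the range of \<open>matrix_inv A ** D\<close>, exceeding its
    rank.\<close>
  have Dres: "D *v w = 0" if w: "\<And>k. k \<in> {1..d} \<Longrightarrow> w \<bullet> (B *v vs k) = 0" for w
  proof (rule ccontr)
    assume nz: "D *v w \<noteq> 0"
    let ?h = "matrix_inv A *v (D *v w)"
    \<comment> \<open>Index 0 is free because the sequence starts at 1, so it holds the extra
      vector.\<close>
    define x where "x k = (if k = 0 then ?h else us k)" for k
    have "?h \<noteq> 0" using nz Ainv[of "D *v w"] by auto
    have hu: "?h \<bullet> (A *v us k) = 0" if "k \<in> {1..d}" for k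
      by (intro pull_u Q w that)
    have "card {0..d} \<le> rank (matrix_inv A ** D)"
    proof (rule form_orthogonal_card_le_rank[OF A, of _ x])
      show "x k \<noteq> 0" if "k \<in> {0..d}" for k
        using that \<open>?h \<noteq> 0\<close> unz[of k] by (auto simp: x_def)
      show "x k \<in> range ((*v) (matrix_inv A ** D))" if k: "k \<in> {0..d}" for k
      proof (cases "k = 0")
        case True
        then show ?thesis by (simp add: x_def matrix_vector_mul_assoc[symmetric])
      next
        case False
        then have k: "k \<in> {1..d}" using k by auto
        have "matrix_inv A *v (D *v ((a k / \<delta> k) *\<^sub>R vs k)) = matrix_inv A *v (A *v us k)"
          using Q[OF k] apos[OF k] by (simp add: Q_def matrix_vector_mult_scaleR)
        also have "\<dots> = us k" by (simp add: matrix_vector_mul_assoc sym_pos_def_inv[OF A])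
        finally have "us k = (matrix_inv A ** D) *v ((a k / \<delta> k) *\<^sub>R vs k)"
          by (simp add: matrix_vector_mul_assoc)
        then show ?thesis using False unfolding x_def by (metis rangeI)
      qed
      show "x k \<bullet> (A *v x l) = 0" if "k \<in> {0..d}" "l \<in> {0..d}" "k \<noteq> l" for k l
      proof -
        have "k = 0 \<and> l \<in> {1..d} \<or> l = 0 \<and> k \<in> {1..d} \<or> k \<in> {1..d} \<and> l \<in> {1..d}"
          using that by auto
        then consider "k = 0" "l \<in> {1..d}" | "l = 0" "k \<in> {1..d}" | "k \<in> {1..d}" "l \<in> {1..d}"
          by blast
        then show ?thesis
        proof cases
          case 1
          then show ?thesis using hu by (simp add: x_def)
        next
          case 2
          then show ?thesis using hu symA[of "us k"] by (simp add: x_def)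
        next
          case 3
          then show ?thesis using orthu[of "Suc d" k l] Q' that(3)
            by (simp add: x_def atLeastLessThanSuc_atLeastAtMost)
        qed
      qed
    qed simp
    also have "\<dots> \<le> rank D" by (rule rank_mul_le_right)
    finally show False using d by simp
  qed
  show "(\<Sum>j=1..d. ((us j \<bullet> (D *v vs j)) / ((us j \<bullet> (A *v us j)) * (vs j \<bullet> (B *v vs j))))
           *\<^sub>R outer_prod (us j) (vs j)) = matrix_inv A ** D ** matrix_inv B" (is "?L = ?R")
  proof -
    \<comment> \<open>Expand \<open>matrix_inv B *v y\<close> along the \<open>vs k\<close>. The
      residual is killed by \<open>D\<close>, and stationarity turns each \<open>D *v vs k\<close>
      into a multiple of \<open>A *v us k\<close>.\<close>
    have "?L *v y = ?R *v y" for y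
    proof -
      let ?v = "matrix_inv B *v y"
      let ?w = "\<Sum>k\<in>{1..d}. (?v \<bullet> (B *v vs k) / (vs k \<bullet> (B *v vs k))) *\<^sub>R vs k"
      have Bv: "?v \<bullet> (B *v x) = x \<bullet> y" for x by (subst symB) (simp add: Binv)
      have "D *v (?v - ?w) = 0"
        by (intro Dres form_orthogonal_residual[OF B])
          (use orthv[of "Suc d"] Q' vnz in \<open>auto simp: atLeastLessThanSuc_atLeastAtMost\<close>)
      then have "D *v ?v = D *v ?w" by (simp add: matrix_vector_mult_diff_distrib)
      also have "\<dots> = (\<Sum>k\<in>{1..d}. (vs k \<bullet> y / b k) *\<^sub>R (D *v vs k))"
        by (simp add: linear_sum[OF matrix_vector_mul_linear] matrix_vector_mult_scaleR Bv b_def)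
      also have "\<dots> = (\<Sum>k\<in>{1..d}. (\<delta> k / (a k * b k)) *\<^sub>R (vs k \<bullet> y) *\<^sub>R (A *v us k))"
        using Q by (intro sum.cong refl) (simp add: Q_def field_simps)
      finally have "matrix_inv A *v (D *v ?v)
          = (\<Sum>k\<in>{1..d}. (\<delta> k / (a k * b k)) *\<^sub>R (vs k \<bullet> y) *\<^sub>R (matrix_inv A *v (A *v us k)))"
        by (simp add: linear_sum[OF matrix_vector_mul_linear] matrix_vector_mult_scaleR)
      also have "\<dots> = (\<Sum>k\<in>{1..d}. (\<delta> k / (a k * b k)) *\<^sub>R (outer_prod (us k) (vs k) *v y))"
        by (simp add: matrix_vector_mul_assoc sym_pos_def_inv[OF A] outer_prod_mult_vec)
      also have "\<dots> = ?L *v y"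
        by (simp add: a_def b_def \<delta>_def scaleR_matrix_vector_assoc sum_matrix_vector_mult)
      finally show ?thesis by (simp add: matrix_vector_mul_assoc matrix_mul_assoc)
    qed
    then show ?thesis by (simp add: matrix_eq)
  qed
qed

section \<open>Moments of matrix normal distributions\<close>

text \<open>Induction over nonnegative measurable functions, starting from the measure of a set; in
  the limit step the two suprema add because both sequences increase.\<close>

lemma nn_integral_mixture:
  assumes sets: "sets P2 = sets P1" and f: "f \<in> borel_measurable P1"
  shows "(\<integral>\<^sup>+x. f x \<partial>mixture a1 P1 a2 P2) = ennreal a1 * (\<integral>\<^sup>+x. f x \<partial>P1) + ennreal a2 * (\<integral>\<^sup>+x. f x \<partial>P2)"
  using f
proof induct
  have sp: "space P2 = space P1" using sets by (rule sets_eq_imp_space_eq)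
  have meas: "g \<in> borel_measurable (mixture a1 P1 a2 P2)" "g \<in> borel_measurable P2"
    if "g \<in> borel_measurable P1" for g :: "'a \<Rightarrow> ennreal"
    using that sets by (auto cong: measurable_cong_sets)
  {
    case (cong f g)
    have "integral\<^sup>N P f = integral\<^sup>N P g" if "space P = space P1" for P
      by (rule nn_integral_cong) (simp add: that cong(3))
    from this[of "mixture a1 P1 a2 P2"] this[of P1] this[of P2] show ?case
      using cong(4) sp by simp
  next
    case (set A)
    then show ?case using sets by (simp add: emeasure_mixture)
  next
    case (mult u c)
    then show ?case
      by (simp add: nn_integral_cmult meas distrib_left mult.left_commute)
  next
    case (add u v)
    then show ?case
      by (simp add: nn_integral_add meas distrib_left add_ac)
  next
    case (seq U)
    have mono: "incseq (\<lambda>i. c * integral\<^sup>N P (U i))" for c P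
      using seq(4) by (auto simp: incseq_def le_fun_def intro!: mult_left_mono nn_integral_mono)
    have conv: "integral\<^sup>N P (Sup (range U)) = (SUP i. integral\<^sup>N P (U i))"
      if "\<And>i. U i \<in> borel_measurable P" for P
    proof -
      have "Sup (range U) = (\<lambda>x. SUP i. U i x)" by (simp add: fun_eq_iff image_comp)
      then show ?thesis using nn_integral_monotone_convergence_SUP[OF seq(4) that] by simp
    qed
    show ?case
      unfolding conv[OF meas(1)[OF seq(1)]] conv[OF seq(1)] conv[OF meas(2)[OF seq(1)]]
        seq(3) SUP_mult_left_ennreal
      by (rule ennreal_SUP_add[OF mono mono])
  }
qed

text \<open>Positive and negative parts are integrated separately by
  \<open>nn_integral_mixture\<close>; finiteness of all four integrals permits the return to real
  numbers.\<close>

lemma has_bochner_integral_mixture: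
  fixes f :: "'a \<Rightarrow> real"
  assumes sets: "sets P2 = sets P1" and a: "a1 \<ge> 0" "a2 \<ge> 0"
    and f: "has_bochner_integral P1 f x1" "has_bochner_integral P2 f x2"
  shows "has_bochner_integral (mixture a1 P1 a2 P2) f (a1 * x1 + a2 * x2)"
proof -
  let ?M = "mixture a1 P1 a2 P2"
  have int: "integrable P1 f" "integrable P2 f"
    and val: "integral\<^sup>L P1 f = x1" "integral\<^sup>L P2 f = x2"
    using f by (auto simp: has_bochner_integral_iff)
  have meas: "f \<in> borel_measurable P1" using int by simp
  have nn: "(\<integral>\<^sup>+x. ennreal (f x) \<partial>?M) = ennreal a1 * (\<integral>\<^sup>+x. ennreal (f x) \<partial>P1) + ennreal a2 * (\<integral>\<^sup>+x. ennreal (f x) \<partial>P2)"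
    "(\<integral>\<^sup>+x. ennreal (- f x) \<partial>?M) = ennreal a1 * (\<integral>\<^sup>+x. ennreal (- f x) \<partial>P1) + ennreal a2 * (\<integral>\<^sup>+x. ennreal (- f x) \<partial>P2)"
    using meas by (simp_all add: nn_integral_mixture[OF sets])
  have fin: "(\<integral>\<^sup>+x. ennreal (f x) \<partial>P1) < top" "(\<integral>\<^sup>+x. ennreal (- f x) \<partial>P1) < top"
    "(\<integral>\<^sup>+x. ennreal (f x) \<partial>P2) < top" "(\<integral>\<^sup>+x. ennreal (- f x) \<partial>P2) < top"
    using int by (auto simp: real_integrable_def less_top)
  have fin': "ennreal a * y < top" if "y < top" for a y
    using that by (simp add: ennreal_mult_less_top)
  have "f \<in> borel_measurable ?M"
    using meas by (auto cong: measurable_cong_sets)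
  then have intM: "integrable ?M f"
    using fin by (simp add: real_integrable_def nn ennreal_mult_eq_top_iff less_top)
  have "integral\<^sup>L ?M f = a1 * x1 + a2 * x2"
    unfolding real_lebesgue_integral_def[OF intM] nn val[symmetric]
      real_lebesgue_integral_def[OF int(1)] real_lebesgue_integral_def[OF int(2)]
      enn2real_plus[OF fin'[OF fin(1)] fin'[OF fin(3)]]
      enn2real_plus[OF fin'[OF fin(2)] fin'[OF fin(4)]] enn2real_mult
    using a by (simp add: algebra_simps)
  with intM show ?thesis by (simp add: has_bochner_integral_iff)
qed

text \<open>The argument \<open>s\<close> is the variance, not the standard deviation.\<close>

definition normal_moment :: "nat \<Rightarrow> real \<Rightarrow> real \<Rightarrow> real" where
  "normal_moment n m s = (\<Sum>k\<le>n. (n choose k) *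
     (if even k then s ^ (k div 2) * fact k / (2 ^ (k div 2) * fact (k div 2)) else 0) * m ^ (n - k))"

lemma normal_moment_simps:
  "normal_moment (Suc 0) m s = m"
  "normal_moment 2 m s = s + m\<^sup>2"
  "normal_moment 3 m s = 3 * s * m + m ^ 3"
  "normal_moment 4 m s = 3 * s\<^sup>2 + 6 * s * m\<^sup>2 + m ^ 4"
proof -
  have "{..Suc 0} = {0, 1}" "{..2::nat} = {0, 1, 2}" "{..3::nat} = {0, 1, 2, 3}"
    "{..4::nat} = {0, 1, 2, 3, 4}" by auto
  moreover have "(3 choose 2) = 3" "(4 choose 2) = 6" by (simp_all add: numeral_eq_Suc)
  ultimately show "normal_moment (Suc 0) m s = m" "normal_moment 2 m s = s + m\<^sup>2"
    "normal_moment 3 m s = 3 * s * m + m ^ 3"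
    "normal_moment 4 m s = 3 * s\<^sup>2 + 6 * s * m\<^sup>2 + m ^ 4"
    by (simp_all add: normal_moment_def fact_numeral)
qed

text \<open>Covers the degenerate case \<open>u = 0\<close> or \<open>v = 0\<close>, where the form
  is constant, so that the moment formula needs no side condition.\<close>

lemma normal_moment_0_right: "normal_moment n m 0 = m ^ n"
proof -
  have "normal_moment n m 0 = (\<Sum>k\<le>n. if k = 0 then m ^ n else 0)"
    unfolding normal_moment_def by (intro sum.cong refl) (auto elim!: evenE simp: zero_power)
  then show ?thesis by simp
qed

text \<open>Expand \<open>x - c\<close> binomially around the mean; odd central moments vanish and
  the even ones are the known Gaussian values.\<close>

lemma has_bochner_integral_normal_moment:
  assumes s: "s > 0"
  shows "has_bochner_integral (density lborel (normal_density \<mu> (sqrt s))) (\<lambda>x. (x - c) ^ n)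
    (normal_moment n (\<mu> - c) s)"
proof (rule has_bochner_integral_density)
  have sq: "sqrt s > 0" using s by simp
  let ?m = "\<lambda>k. if even k then s ^ (k div 2) * fact k / (2 ^ (k div 2) * fact (k div 2)) else 0 :: real"
  have central: "has_bochner_integral lborel (\<lambda>x. normal_density \<mu> (sqrt s) x * (x - \<mu>) ^ k) (?m k)" for k
  proof (cases "even k")
    case True
    then obtain l where "k = 2 * l" by blast
    then show ?thesis
      using normal_moment_even[OF sq, of \<mu> l] s by (simp add: power_divide mult.commute)
  next
    case False
    then obtain l where "k = 2 * l + 1" using oddE by blast
    then show ?thesis using normal_moment_odd[OF sq, of \<mu> l] by simp
  qed
  have "(\<lambda>x. normal_density \<mu> (sqrt s) x *\<^sub>R (x - c) ^ n) = (\<lambda>x. \<Sum>k\<le>n.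
      (normal_density \<mu> (sqrt s) x * (x - \<mu>) ^ k) * ((n choose k) * (\<mu> - c) ^ (n - k)))"
  proof
    fix x
    have "(x - c) ^ n = ((x - \<mu>) + (\<mu> - c)) ^ n" by simp
    also have "\<dots> = (\<Sum>k\<le>n. (n choose k) * (x - \<mu>) ^ k * (\<mu> - c) ^ (n - k))"
      by (rule binomial_ring)
    finally show "normal_density \<mu> (sqrt s) x *\<^sub>R (x - c) ^ n = (\<Sum>k\<le>n.
        (normal_density \<mu> (sqrt s) x * (x - \<mu>) ^ k) * ((n choose k) * (\<mu> - c) ^ (n - k)))"
      by (simp add: sum_distrib_left mult_ac)
  qed
  moreover have "has_bochner_integral lborel (\<lambda>x. \<Sum>k\<le>n.
      (normal_density \<mu> (sqrt s) x * (x - \<mu>) ^ k) * ((n choose k) * (\<mu> - c) ^ (n - k)))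
      (\<Sum>k\<le>n. ?m k * ((n choose k) * (\<mu> - c) ^ (n - k)))"
    by (intro has_bochner_integral_sum has_bochner_integral_mult_left central)
  ultimately show "has_bochner_integral lborel (\<lambda>x. normal_density \<mu> (sqrt s) x *\<^sub>R (x - c) ^ n)
      (normal_moment n (\<mu> - c) s)"
    by (simp add: normal_moment_def mult_ac)
qed (use s in \<open>auto simp: normal_density_nonneg\<close>)

section \<open>Normal laws of linear and bilinear forms\<close>

text \<open>Coordinates of a product measure are independent, and sums of independent normal
  variables are normal with added variances.\<close>

lemma distributed_std_normal_linear_combination:
  fixes c :: "'i::finite \<Rightarrow> real"
  assumes c: "c \<noteq> (\<lambda>_. 0)"
  shows "distributed (\<Pi>\<^sub>M _\<in>(UNIV :: 'i set). density lborel (\<lambda>x. ennreal (std_normal_density x))) lborel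
    (\<lambda>z. t + (\<Sum>i\<in>UNIV. c i * z i)) (normal_density t (sqrt (\<Sum>i\<in>UNIV. (c i)\<^sup>2)))"
proof -
  let ?N = "density lborel (\<lambda>x. ennreal (std_normal_density x))"
  let ?P = "\<Pi>\<^sub>M _\<in>(UNIV :: 'i set). ?N"
  \<comment> \<open>Zero coefficients give degenerate summands without a density; they are removed
    before the sum law is applied.\<close>
  let ?I = "{i. c i \<noteq> 0}"
  interpret N: prob_space ?N by (rule prob_space_normal_density) simp
  interpret P: prob_space ?P by (intro prob_space_PiM N.prob_space_axioms)
  have coord: "distr ?P ?N (\<lambda>z. z i) = ?N" for i
    by (rule distr_PiM_component) (auto intro: N.prob_space_axioms)
  have "P.indep_vars (\<lambda>_. ?N) (\<lambda>i z. z i) UNIV"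
    by (subst P.indep_vars_iff_distr_eq_PiM') (auto simp: coord restrict_UNIV distr_id2)
  then have "P.indep_vars (\<lambda>_. borel) (\<lambda>i z. c i * z i) UNIV"
    by (rule P.indep_vars_compose2) simp
  then have indep: "P.indep_vars (\<lambda>_. borel) (\<lambda>i z. c i * z i) ?I"
    by (rule P.indep_vars_subset) simp
  have std: "distributed ?P lborel (\<lambda>z. z i) (\<lambda>x. ennreal (std_normal_density x))" for i
  proof -
    have "distr ?P lborel (\<lambda>z. z i) = distr ?P ?N (\<lambda>z. z i)"
      by (rule distr_cong) auto
    moreover have "(\<lambda>z. z i) \<in> measurable ?P lborel"
      using measurable_component_singleton[of i UNIV "\<lambda>_. ?N"]
      by (simp cong: measurable_cong_sets)
    ultimately show ?thesis by (simp add: distributed_def coord)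
  qed
  have "distributed ?P lborel (\<lambda>z. c i * z i) (normal_density 0 \<bar>c i\<bar>)" if "i \<in> ?I" for i
    using P.normal_density_affine[OF std, of "c i" 0 i] that by simp
  then have "distributed ?P lborel (\<lambda>z. \<Sum>i\<in>?I. c i * z i)
      (normal_density (\<Sum>i\<in>?I. 0) (sqrt (\<Sum>i\<in>?I. \<bar>c i\<bar>\<^sup>2)))"
    using c by (intro P.sum_indep_normal indep) auto
  moreover have "(\<Sum>i\<in>?I. c i * z i) = (\<Sum>i\<in>UNIV. c i * z i)" for z
    by (rule sum.mono_neutral_left) auto
  moreover have "(\<Sum>i\<in>?I. \<bar>c i\<bar>\<^sup>2) = (\<Sum>i\<in>UNIV. (c i)\<^sup>2)"
    by (simp, rule sum.mono_neutral_left) auto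
  ultimately have *: "distributed ?P lborel (\<lambda>z. \<Sum>i\<in>UNIV. c i * z i)
      (normal_density 0 (sqrt (\<Sum>i\<in>UNIV. (c i)\<^sup>2)))" by simp
  have "sqrt (\<Sum>i\<in>UNIV. (c i)\<^sup>2) > 0"
  proof -
    obtain i where "c i \<noteq> 0" using c by auto
    then show ?thesis by (auto intro!: sum_pos2[of _ i])
  qed
  from P.normal_density_affine[OF * this, of 1 t] show ?thesis by simp
qed

text \<open>Entries are bilinear forms at unit vectors, so statements about all forms
  \<open>u \<bullet> (x *v v)\<close> yield entrywise integrability.\<close>

lemma matrix_component_inner: "x $ i $ j = axis i 1 \<bullet> (x *v axis j 1)" for x :: "real^'q^'p"
  by (simp add: inner_axis' matrix_vector_mul_component inner_axis)

lemma matrix_Basis_inner: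
  assumes "b \<in> Basis"
  shows "\<exists>i j. \<forall>x :: real^'q^'p. x \<bullet> b = x $ i $ j"
proof -
  obtain i j where "b = axis i (axis j 1)" using assms by (auto simp: Basis_vec_def)
  then have "\<forall>x :: real^'q^'p. x \<bullet> b = x $ i $ j" by (simp add: inner_axis)
  then show ?thesis by (intro exI)
qed

lemma borel_measurable_matrixI:
  fixes f :: "'a \<Rightarrow> real^'q^'p"
  assumes "\<And>i j. (\<lambda>\<omega>. f \<omega> $ i $ j) \<in> borel_measurable M"
  shows "f \<in> borel_measurable M"
proof (rule borel_measurable_euclidean_space[THEN iffD2], rule ballI)
  fix b :: "real^'q^'p" assume "b \<in> Basis"
  from matrix_Basis_inner[OF this]
  obtain i j where "\<forall>x :: real^'q^'p. x \<bullet> b = x $ i $ j" by (elim exE)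
  then show "(\<lambda>\<omega>. f \<omega> \<bullet> b) \<in> borel_measurable M" using assms by simp
qed

lemma integrable_matrixI:
  fixes f :: "'a \<Rightarrow> real^'q^'p"
  assumes "\<And>i j. integrable M (\<lambda>\<omega>. f \<omega> $ i $ j)"
  shows "integrable M f"
proof -
  have "integrable M (\<lambda>\<omega>. \<Sum>b\<in>Basis. (f \<omega> \<bullet> b) *\<^sub>R b)"
  proof (intro Bochner_Integration.integrable_sum integrable_scaleR_left)
    fix b :: "real^'q^'p" assume "b \<in> Basis"
    from matrix_Basis_inner[OF this]
    obtain i j where "\<forall>x :: real^'q^'p. x \<bullet> b = x $ i $ j" by (elim exE)
    then show "integrable M (\<lambda>\<omega>. f \<omega> \<bullet> b)" using assms by simp
  qed
  then show ?thesis by (simp add: euclidean_representation)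
qed

lemma linear_matrix_form: "linear (\<lambda>x. u \<bullet> (x *v v))" for u :: "real^'p" and v :: "real^'q"
  by (intro linearI)
    (simp_all add: matrix_vector_mult_add_rdistrib inner_add_right scaleR_matrix_vector_assoc[symmetric])

lemma bounded_linear_matrix_form: "bounded_linear (\<lambda>x. u \<bullet> (x *v v))"
  for u :: "real^'p" and v :: "real^'q"
  using linear_matrix_form by (simp add: linear_conv_bounded_linear)

lemma borel_measurable_matrix_form [measurable]: "(\<lambda>x. u \<bullet> (x *v v)) \<in> borel_measurable borel"
  for u :: "real^'p" and v :: "real^'q"
  by (rule borel_measurable_continuous_onI)
    (rule linear_continuous_on[OF bounded_linear_matrix_form])

lemma integral_matrix_form:
  fixes f :: "'a \<Rightarrow> real^'q^'p"
  assumes "integrable M f"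
  shows "u \<bullet> ((\<integral>\<omega>. f \<omega> \<partial>M) *v v) = (\<integral>\<omega>. u \<bullet> (f \<omega> *v v) \<partial>M)"
  by (rule integral_bounded_linear[OF bounded_linear_matrix_form assms, symmetric])

text \<open>Moving the symmetric roots onto \<open>u\<close> and \<open>v\<close> writes the form as
  a linear combination of independent standard normals. The coefficients are products of
  coordinates, so their sum of squares factors into the two quadratic forms.\<close>

lemma matrix_normal_form:
  fixes A :: "real^'p^'p" and B :: "real^'q^'q"
  assumes A: "sym_pos_def A" and B: "sym_pos_def B" and u: "u \<noteq> 0" and v: "v \<noteq> 0"
  shows "distr (matrix_normal T A B) borel (\<lambda>x. u \<bullet> (x *v v))
    = density lborel (normal_density (u \<bullet> (T *v v)) (sqrt ((u \<bullet> (A *v u)) * (v \<bullet> (B *v v)))))"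
proof -
  let ?N = "density lborel (\<lambda>x. ennreal (std_normal_density x))"
  let ?P = "\<Pi>\<^sub>M _\<in>(UNIV :: ('p \<times> 'q) set). ?N"
  let ?S = "matrix_sqrt A" and ?R = "matrix_sqrt B"
  let ?Z = "\<lambda>z :: 'p \<times> 'q \<Rightarrow> real. (\<chi> i j. z (i, j)) :: real^'q^'p"
  let ?g = "\<lambda>z. T + ?S ** ?Z z ** ?R"
  define c where "c ij = (?S *v u) $ fst ij * (?R *v v) $ snd ij" for ij
  have meas: "?g \<in> measurable ?P borel"
  proof (rule borel_measurable_matrixI)
    have [measurable]: "(\<lambda>z. z ij) \<in> borel_measurable ?P" for ij
      using measurable_component_singleton[of ij UNIV "\<lambda>_. ?N"]
      by (simp cong: measurable_cong_sets)
    show "(\<lambda>z. ?g z $ i $ j) \<in> borel_measurable ?P" for i j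
      by (simp add: matrix_matrix_mult_def)
  qed
  have form: "u \<bullet> (?g z *v v) = u \<bullet> (T *v v) + (\<Sum>ij\<in>UNIV. c ij * z ij)" for z
  proof -
    have "u \<bullet> ((?S ** ?Z z ** ?R) *v v) = u \<bullet> (?S *v (?Z z *v (?R *v v)))"
      by (simp add: matrix_vector_mul_assoc matrix_mul_assoc)
    also have "\<dots> = (?S *v u) \<bullet> (?Z z *v (?R *v v))"
      by (rule sym_pos_defD(5)[OF matrix_sqrt(1)[OF A]])
    also have "\<dots> = (\<Sum>i\<in>UNIV. \<Sum>j\<in>UNIV. c (i, j) * z (i, j))"
      unfolding inner_vec_def matrix_vector_mult_def[of "?Z z"] c_def
      by (simp add: sum_distrib_left mult_ac)
    also have "\<dots> = (\<Sum>ij\<in>UNIV. c ij * z ij)"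
      by (simp add: sum.cartesian_product)
    finally show ?thesis by (simp add: matrix_vector_mult_add_rdistrib inner_add_right)
  qed
  have var: "(\<Sum>ij\<in>UNIV. (c ij)\<^sup>2) = (u \<bullet> (A *v u)) * (v \<bullet> (B *v v))"
  proof -
    have "(\<Sum>ij\<in>UNIV. (c ij)\<^sup>2) = (\<Sum>i\<in>UNIV. \<Sum>j\<in>UNIV. (c (i, j))\<^sup>2)"
      by (simp add: sum.cartesian_product)
    also have "\<dots> = (norm (?S *v u))\<^sup>2 * (norm (?R *v v))\<^sup>2"
      by (simp add: c_def norm_vec_def L2_set_def sum_nonneg sum_product power_mult_distrib)
    finally show ?thesis by (simp add: norm_matrix_sqrt_mult[OF A] norm_matrix_sqrt_mult[OF B])
  qed
  have "c \<noteq> (\<lambda>_. 0)"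
  proof
    assume "c = (\<lambda>_. 0)"
    then have "(u \<bullet> (A *v u)) * (v \<bullet> (B *v v)) = 0" by (simp flip: var)
    then show False using sym_pos_defD(4)[OF A, of u] sym_pos_defD(4)[OF B, of v] u v by simp
  qed
  from distributed_std_normal_linear_combination[OF this, of "u \<bullet> (T *v v)"]
  have "distr ?P lborel (\<lambda>z. u \<bullet> (?g z *v v))
      = density lborel (normal_density (u \<bullet> (T *v v)) (sqrt ((u \<bullet> (A *v u)) * (v \<bullet> (B *v v)))))"
    by (simp add: distributed_def form var)
  moreover have "distr (matrix_normal T A B) borel (\<lambda>x. u \<bullet> (x *v v)) = distr ?P borel (\<lambda>z. u \<bullet> (?g z *v v))"
    unfolding matrix_normal_def
    by (subst distr_distr[OF borel_measurable_matrix_form meas]) (simp add: comp_def)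
  \<comment> \<open>\<open>borel\<close> and \<open>lborel\<close> have the same measurable sets,
    and nothing else of the target measure enters \<open>distr\<close>.\<close>
  moreover have "distr ?P borel (\<lambda>z. u \<bullet> (?g z *v v)) = distr ?P lborel (\<lambda>z. u \<bullet> (?g z *v v))"
    by (rule distr_cong) auto
  ultimately show ?thesis by simp
qed

lemma sets_matrix_normal [simp]: "sets (matrix_normal T A B) = sets borel"
  by (simp add: matrix_normal_def)

lemma prob_space_matrix_normal:
  fixes T :: "real^'q^'p"
  assumes A: "sym_pos_def A" and B: "sym_pos_def B"
  shows "prob_space (matrix_normal T A B)"
proof -
  \<comment> \<open>One nondegenerate form suffices, here at the all-ones vectors: its law is a
    normal probability measure, and a pushforward preserves total mass.\<close>
  let ?u = "1 :: real^'p" and ?v = "1 :: real^'q"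
  have nz: "?u \<noteq> 0" "?v \<noteq> 0" by simp_all
  have "(?u \<bullet> (A *v ?u)) * (?v \<bullet> (B *v ?v)) > 0"
    using sym_pos_defD(2)[OF A nz(1)] sym_pos_defD(2)[OF B nz(2)] by simp
  then have "prob_space (distr (matrix_normal T A B) borel (\<lambda>x. ?u \<bullet> (x *v ?v)))"
    unfolding matrix_normal_form[OF A B nz] by (intro prob_space_normal_density) simp
  then show ?thesis
    by (rule prob_space_distrD[rotated]) (simp cong: measurable_cong_sets)
qed

lemma has_bochner_integral_matrix_normal_form:
  fixes A :: "real^'p^'p" and B :: "real^'q^'q"
  assumes A: "sym_pos_def A" and B: "sym_pos_def B"
  shows "has_bochner_integral (matrix_normal T A B) (\<lambda>x. (u \<bullet> (x *v v) - c) ^ n)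
    (normal_moment n (u \<bullet> (T *v v) - c) ((u \<bullet> (A *v u)) * (v \<bullet> (B *v v))))"
proof (cases "u = 0 \<or> v = 0")
  case True
  interpret prob_space "matrix_normal T A B" by (rule prob_space_matrix_normal[OF A B])
  from True show ?thesis
    by (auto simp: normal_moment_0_right has_bochner_integral_iff prob_space)
next
  case False
  then have pos: "(u \<bullet> (A *v u)) * (v \<bullet> (B *v v)) > 0"
    using sym_pos_defD(2)[OF A, of u] sym_pos_defD(2)[OF B, of v] by simp
  have "(\<lambda>x. u \<bullet> (x *v v)) \<in> measurable (matrix_normal T A B) borel"
    by (simp cong: measurable_cong_sets)
  moreover have "has_bochner_integral (distr (matrix_normal T A B) borel (\<lambda>x. u \<bullet> (x *v v))) (\<lambda>y. (y - c) ^ n)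
      (normal_moment n (u \<bullet> (T *v v) - c) ((u \<bullet> (A *v u)) * (v \<bullet> (B *v v))))"
    using matrix_normal_form[OF A B] False has_bochner_integral_normal_moment[OF pos] by simp
  ultimately show ?thesis
    by (simp add: has_bochner_integral_iff integrable_distr_eq integral_distr)
qed

section \<open>Kurtosis of normal mixtures\<close>

locale matrix_normal_mixture =
  fixes M :: "'a measure" and X :: "'a \<Rightarrow> real^'q^'p"
    and A :: "real^'p^'p" and B :: "real^'q^'q" and T1 T2 :: "real^'q^'p" and \<alpha>1 \<alpha>2 :: real
  assumes prob: "prob_space M" and meas [measurable]: "X \<in> borel_measurable M"
    and \<alpha>1: "\<alpha>1 \<in> {0<..<1}" and \<alpha>2: "\<alpha>2 = 1 - \<alpha>1"
    and A: "sym_pos_def A" and B: "sym_pos_def B"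
    and law: "distr M borel X = mixture \<alpha>1 (matrix_normal T1 A B) \<alpha>2 (matrix_normal T2 A B)"
begin

abbreviation \<beta> :: real where "\<beta> \<equiv> \<alpha>1 * \<alpha>2"

abbreviation \<delta> :: "real^'p \<Rightarrow> real^'q \<Rightarrow> real" where "\<delta> u v \<equiv> u \<bullet> ((T2 - T1) *v v)"

abbreviation s :: "real^'p \<Rightarrow> real^'q \<Rightarrow> real" where "s u v \<equiv> (u \<bullet> (A *v u)) * (v \<bullet> (B *v v))"

lemma \<beta>_pos: "\<beta> > 0" using \<alpha>1 \<alpha>2 by simp

lemma s_pos: "u \<noteq> 0 \<Longrightarrow> v \<noteq> 0 \<Longrightarrow> s u v > 0"
  using sym_pos_defD(2)[OF A, of u] sym_pos_defD(2)[OF B, of v] by simp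

section \<open>Moments of projections of the mixture\<close>

lemma form_moment:
  "has_bochner_integral M (\<lambda>\<omega>. (u \<bullet> (X \<omega> *v v) - c) ^ n)
    (\<alpha>1 * normal_moment n (u \<bullet> (T1 *v v) - c) (s u v) + \<alpha>2 * normal_moment n (u \<bullet> (T2 *v v) - c) (s u v))"
proof -
  have "has_bochner_integral (distr M borel X) (\<lambda>x. (u \<bullet> (x *v v) - c) ^ n)
    (\<alpha>1 * normal_moment n (u \<bullet> (T1 *v v) - c) (s u v) + \<alpha>2 * normal_moment n (u \<bullet> (T2 *v v) - c) (s u v))"
    unfolding law
    by (intro has_bochner_integral_mixture has_bochner_integral_matrix_normal_form A B)
      (use \<alpha>1 \<alpha>2 in auto)
  then show ?thesis
    by (simp add: has_bochner_integral_iff integrable_distr_eq integral_distr)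
qed

lemma integrable_X: "integrable M X"
proof (rule integrable_matrixI)
  show "integrable M (\<lambda>\<omega>. X \<omega> $ i $ j)" for i j
    using form_moment[of "axis i 1" "axis j 1" 0 "Suc 0"]
    by (simp add: matrix_component_inner has_bochner_integral_iff)
qed

lemma centered_form:
  "u \<bullet> (centered M X \<omega> *v v) = u \<bullet> (X \<omega> *v v) - (\<alpha>1 * (u \<bullet> (T1 *v v)) + \<alpha>2 * (u \<bullet> (T2 *v v)))"
proof -
  have "u \<bullet> ((\<integral>\<omega>. X \<omega> \<partial>M) *v v) = \<alpha>1 * (u \<bullet> (T1 *v v)) + \<alpha>2 * (u \<bullet> (T2 *v v))"
    using form_moment[of u v 0 "Suc 0"]
    by (simp add: integral_matrix_form[OF integrable_X] has_bochner_integral_iff normal_moment_simps)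
  then show ?thesis
    by (simp add: centered_def matrix_vector_mult_diff_rdistrib inner_diff_right)
qed

text \<open>Since the weights add to one, subtracting the weighted mean moves the component means to
  \<open>- \<alpha>2 * \<delta> u v\<close> and \<open>\<alpha>1 * \<delta> u v\<close>.\<close>

lemma centered_moment:
  "has_bochner_integral M (\<lambda>\<omega>. (u \<bullet> (centered M X \<omega> *v v)) ^ n)
    (\<alpha>1 * normal_moment n (- \<alpha>2 * \<delta> u v) (s u v) + \<alpha>2 * normal_moment n (\<alpha>1 * \<delta> u v) (s u v))"
proof -
  let ?c = "\<alpha>1 * (u \<bullet> (T1 *v v)) + \<alpha>2 * (u \<bullet> (T2 *v v))"
  have "u \<bullet> (T1 *v v) - ?c = - \<alpha>2 * \<delta> u v" "u \<bullet> (T2 *v v) - ?c = \<alpha>1 * \<delta> u v"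
    by (simp_all add: \<alpha>2 matrix_vector_mult_diff_rdistrib inner_diff_right algebra_simps)
  then show ?thesis using form_moment[of u v ?c n] by (simp add: centered_form)
qed

lemma proj_moments:
  "proj_moment 2 M X u v = s u v + \<beta> * (\<delta> u v)\<^sup>2"
  "proj_moment 3 M X u v = \<beta> * (\<alpha>1 - \<alpha>2) * (\<delta> u v) ^ 3"
  "proj_moment 4 M X u v = 3 * (s u v)\<^sup>2 + 6 * \<beta> * s u v * (\<delta> u v)\<^sup>2 + \<beta> * (1 - 3 * \<beta>) * (\<delta> u v) ^ 4"
proof -
  define x y where "x = \<delta> u v" and "y = s u v"
  have pm: "proj_moment n M X u v = \<alpha>1 * normal_moment n (- \<alpha>2 * x) y + \<alpha>2 * normal_moment n (\<alpha>1 * x) y" for n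
    using centered_moment[of u v n] by (simp add: proj_moment_def has_bochner_integral_iff x_def y_def)
  have "proj_moment 2 M X u v = y + \<beta> * x\<^sup>2"
    "proj_moment 3 M X u v = \<beta> * (\<alpha>1 - \<alpha>2) * x ^ 3"
    "proj_moment 4 M X u v = 3 * y\<^sup>2 + 6 * \<beta> * y * x\<^sup>2 + \<beta> * (1 - 3 * \<beta>) * x ^ 4"
    unfolding pm normal_moment_simps \<alpha>2 by algebra+
  then show "proj_moment 2 M X u v = s u v + \<beta> * (\<delta> u v)\<^sup>2"
    "proj_moment 3 M X u v = \<beta> * (\<alpha>1 - \<alpha>2) * (\<delta> u v) ^ 3"
    "proj_moment 4 M X u v = 3 * (s u v)\<^sup>2 + 6 * \<beta> * s u v * (\<delta> u v)\<^sup>2 + \<beta> * (1 - 3 * \<beta>) * (\<delta> u v) ^ 4"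
    unfolding x_def y_def by simp_all
qed

section \<open>The constraint matrices as bilinear forms\<close>

lemma has_bochner_integral_centered_square:
  "has_bochner_integral M (\<lambda>\<omega>. (u \<bullet> (centered M X \<omega> *v v))\<^sup>2) (s u v + \<beta> * (\<delta> u v)\<^sup>2)"
  using centered_moment[of u v 2] proj_moments(1)[of u v]
  by (simp add: proj_moment_def has_bochner_integral_iff)

text \<open>Polarization: the product is a quarter of the difference of the squares at
  \<open>u + w\<close> and \<open>u - w\<close>, whose expectations are second moments.\<close>

lemma has_bochner_integral_centered_product_left:
  "has_bochner_integral M (\<lambda>\<omega>. (u \<bullet> (centered M X \<omega> *v v)) * (w \<bullet> (centered M X \<omega> *v v)))
    ((u \<bullet> (A *v w)) * (v \<bullet> (B *v v)) + \<beta> * \<delta> u v * \<delta> w v)"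
proof -
  have "has_bochner_integral M
    (\<lambda>\<omega>. (((u + w) \<bullet> (centered M X \<omega> *v v))\<^sup>2 - ((u - w) \<bullet> (centered M X \<omega> *v v))\<^sup>2) / 4)
    (((s (u + w) v + \<beta> * (\<delta> (u + w) v)\<^sup>2) - (s (u - w) v + \<beta> * (\<delta> (u - w) v)\<^sup>2)) / 4)"
    by (intro has_bochner_integral_divide_zero has_bochner_integral_diff
        has_bochner_integral_centered_square)
  moreover
  have "w \<bullet> (A *v u) = u \<bullet> (A *v w)"
    using sym_pos_defD(5)[OF A, of w u] by (simp add: inner_commute)
  then have "((s (u + w) v + \<beta> * (\<delta> (u + w) v)\<^sup>2) - (s (u - w) v + \<beta> * (\<delta> (u - w) v)\<^sup>2)) / 4
      = (u \<bullet> (A *v w)) * (v \<bullet> (B *v v)) + \<beta> * \<delta> u v * \<delta> w v"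
    by (simp add: inner_add_left inner_diff_left inner_add_right inner_diff_right
        matrix_vector_right_distrib matrix_vector_mult_diff_distrib power2_eq_square field_simps)
  moreover have "(((u + w) \<bullet> z)\<^sup>2 - ((u - w) \<bullet> z)\<^sup>2) / 4 = (u \<bullet> z) * (w \<bullet> z)" for z
    by (simp add: inner_add_left inner_diff_left power2_eq_square field_simps)
  ultimately show ?thesis by (simp only:)
qed

text \<open>The same polarization in the right argument.\<close>

lemma has_bochner_integral_centered_product_right:
  "has_bochner_integral M (\<lambda>\<omega>. (u \<bullet> (centered M X \<omega> *v v)) * (u \<bullet> (centered M X \<omega> *v w)))
    ((v \<bullet> (B *v w)) * (u \<bullet> (A *v u)) + \<beta> * \<delta> u v * \<delta> u w)"
proof -
  have "has_bochner_integral M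
    (\<lambda>\<omega>. ((u \<bullet> (centered M X \<omega> *v (v + w)))\<^sup>2 - (u \<bullet> (centered M X \<omega> *v (v - w)))\<^sup>2) / 4)
    (((s u (v + w) + \<beta> * (\<delta> u (v + w))\<^sup>2) - (s u (v - w) + \<beta> * (\<delta> u (v - w))\<^sup>2)) / 4)"
    by (intro has_bochner_integral_divide_zero has_bochner_integral_diff
        has_bochner_integral_centered_square)
  moreover
  have "w \<bullet> (B *v v) = v \<bullet> (B *v w)"
    using sym_pos_defD(5)[OF B, of w v] by (simp add: inner_commute)
  then have "((s u (v + w) + \<beta> * (\<delta> u (v + w))\<^sup>2) - (s u (v - w) + \<beta> * (\<delta> u (v - w))\<^sup>2)) / 4
      = (v \<bullet> (B *v w)) * (u \<bullet> (A *v u)) + \<beta> * \<delta> u v * \<delta> u w"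
    by (simp add: inner_add_left inner_diff_left inner_add_right inner_diff_right
        matrix_vector_right_distrib matrix_vector_mult_diff_distrib power2_eq_square field_simps)
  moreover have "((u \<bullet> (C *v (v + w)))\<^sup>2 - (u \<bullet> (C *v (v - w)))\<^sup>2) / 4
      = (u \<bullet> (C *v v)) * (u \<bullet> (C *v w))" for C
    by (simp add: matrix_vector_right_distrib matrix_vector_mult_diff_distrib
        inner_add_right inner_diff_right power2_eq_square field_simps)
  ultimately show ?thesis by (simp only:)
qed

text \<open>The outer product splits the random matrix's form into a product of two projections. At
  unit vectors this gives integrability of the entries, after which form and integral
  commute.\<close>

lemma G1_form:
  "u \<bullet> (G1 M X v *v w) = (u \<bullet> (A *v w)) * (v \<bullet> (B *v v)) + \<beta> * \<delta> u v * \<delta> w v"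
proof -
  let ?C = "centered M X"
  let ?f = "\<lambda>\<omega>. ?C \<omega> ** outer_prod v v ** transpose (?C \<omega>)"
  have form: "x \<bullet> (?f \<omega> *v y) = (x \<bullet> (?C \<omega> *v v)) * (y \<bullet> (?C \<omega> *v v))" for x y \<omega>
  proof -
    have "?f \<omega> *v y = ?C \<omega> *v (outer_prod v v *v (transpose (?C \<omega>) *v y))"
      by (simp only: matrix_vector_mul_assoc matrix_mul_assoc)
    then show ?thesis
      by (simp only: outer_prod_mult_vec matrix_vector_mult_scaleR inner_scaleR_right
          matrix_vector_inner[of y] mult.commute)
  qed
  have "integrable M ?f"
    by (rule integrable_matrixI)
      (simp only: matrix_component_inner form
        has_bochner_integral_centered_product_left[THEN integrable.intros])
  then have "u \<bullet> (G1 M X v *v w) = (\<integral>\<omega>. u \<bullet> (?f \<omega> *v w) \<partial>M)"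
    unfolding G1_def by (rule integral_matrix_form)
  then show ?thesis
    using has_bochner_integral_centered_product_left[of u v w]
    by (simp only: form has_bochner_integral_iff)
qed

lemma G2_form:
  "v \<bullet> (G2 M X u *v w) = (v \<bullet> (B *v w)) * (u \<bullet> (A *v u)) + \<beta> * \<delta> u v * \<delta> u w"
proof -
  let ?C = "centered M X"
  let ?f = "\<lambda>\<omega>. transpose (?C \<omega>) ** outer_prod u u ** ?C \<omega>"
  have form: "x \<bullet> (?f \<omega> *v y) = (u \<bullet> (?C \<omega> *v x)) * (u \<bullet> (?C \<omega> *v y))" for x y \<omega>
  proof -
    have "?f \<omega> *v y = transpose (?C \<omega>) *v (outer_prod u u *v (?C \<omega> *v y))"
      by (simp only: matrix_vector_mul_assoc matrix_mul_assoc)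
    then show ?thesis
      by (simp only: outer_prod_mult_vec matrix_vector_mult_scaleR inner_scaleR_right
          matrix_vector_inner[of u _ x] mult.commute)
  qed
  have "integrable M ?f"
    by (rule integrable_matrixI)
      (simp only: matrix_component_inner form
        has_bochner_integral_centered_product_right[THEN integrable.intros])
  then have "v \<bullet> (G2 M X u *v w) = (\<integral>\<omega>. v \<bullet> (?f \<omega> *v w) \<partial>M)"
    unfolding G2_def by (rule integral_matrix_form)
  then show ?thesis
    using has_bochner_integral_centered_product_right[of u v w]
    by (simp only: form has_bochner_integral_iff)
qed

section \<open>Kurtosis and the coefficients of the sum\<close>

lemma proj_moment_2_pos:
  assumes "u \<noteq> 0" "v \<noteq> 0" shows "proj_moment 2 M X u v > 0"
  unfolding proj_moments using s_pos[OF assms] \<beta>_pos by (simp add: add_pos_nonneg)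

text \<open>Splitting three times the squared second moment off the fourth moment leaves only a
  multiple of \<open>(\<delta> u v) ^ 4\<close>.\<close>

lemma kurt_eq:
  assumes "u \<noteq> 0" "v \<noteq> 0"
  shows "kurt M X u v = 3 + \<beta> * (1 - 6 * \<beta>) * ((\<delta> u v)\<^sup>2 / proj_moment 2 M X u v)\<^sup>2"
proof -
  define m where "m = proj_moment 2 M X u v"
  have m: "m > 0" using proj_moment_2_pos[OF assms] by (simp add: m_def)
  have "proj_moment 4 M X u v = 3 * m\<^sup>2 + \<beta> * (1 - 6 * \<beta>) * ((\<delta> u v)\<^sup>2)\<^sup>2"
    unfolding m_def proj_moments by algebra
  then show ?thesis
    using m by (simp add: kurt_def m_def[symmetric] power_divide add_divide_distrib)
qed

text \<open>The kurtosis formula gives \<open>\<theta> = \<delta>\<^sup>2 / m\<close>, and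
  \<open>1 - \<beta> * \<theta> = s / m\<close>, so \<open>m\<close> cancels in the quotient. Both
  arguments of \<open>max\<close> against 0 are already nonnegative.\<close>

lemma lam_eq:
  assumes "u \<noteq> 0" "v \<noteq> 0" and "1 - 6 * \<beta> \<noteq> 0"
  shows "lam M X \<alpha>1 \<alpha>2 u v = \<bar>\<delta> u v\<bar> / sqrt (s u v)"
proof -
  define m where "m = proj_moment 2 M X u v"
  have m: "m > 0" using proj_moment_2_pos[OF assms(1,2)] by (simp add: m_def)
  have ms: "s u v = m - \<beta> * (\<delta> u v)\<^sup>2" by (simp add: m_def proj_moments)
  have sp: "m - \<beta> * (\<delta> u v)\<^sup>2 > 0" using s_pos[OF assms(1,2)] by (simp add: ms)
  have "(kurt M X u v - 3) / (\<alpha>1 * \<alpha>2 * (1 - 6 * \<alpha>1 * \<alpha>2)) = ((\<delta> u v)\<^sup>2 / m)\<^sup>2"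
    using \<alpha>1 \<alpha>2 assms(3) by (simp add: kurt_eq[OF assms(1,2)] m_def mult.assoc)
  then have th: "theta M X \<alpha>1 \<alpha>2 u v = (\<delta> u v)\<^sup>2 / m"
    using m by (simp add: theta_def max_def)
  have "1 - \<beta> * ((\<delta> u v)\<^sup>2 / m) = s u v / m" using m by (simp add: ms field_simps)
  then have "theta M X \<alpha>1 \<alpha>2 u v / (1 - \<alpha>1 * \<alpha>2 * theta M X \<alpha>1 \<alpha>2 u v) = (\<delta> u v)\<^sup>2 / s u v"
    using m by (simp add: th)
  moreover have "(\<delta> u v)\<^sup>2 / s u v \<ge> 0"
    using s_pos[OF assms(1,2)] by (intro divide_nonneg_pos) simp_all
  ultimately show ?thesis
    by (simp only: lam_def max_absorb1 real_sqrt_divide real_sqrt_abs)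
qed

lemma proj_sign_eq:
  assumes "\<alpha>1 \<noteq> \<alpha>2"
  shows "proj_sign M X \<alpha>1 \<alpha>2 u v = sgn (\<delta> u v)"
proof -
  have "inverse (\<alpha>1 - \<alpha>2) * proj_moment 3 M X u v = \<beta> * (\<delta> u v) ^ 3"
    using assms by (simp add: proj_moments)
  then show ?thesis
    using \<alpha>1 \<alpha>2 by (simp add: proj_sign_def sgn_mult power3_eq_cube) (simp add: sgn_if)
qed

text \<open>With \<open>\<lambda> = \<bar>\<delta>\<bar> / sqrt s\<close> one has
  \<open>1 + \<beta> * \<lambda>\<^sup>2 = m / s\<close>; the factor \<open>sqrt m\<close> cancels,
  and the sign restores \<open>\<delta>\<close> from its absolute value.\<close>

lemma summand_coefficient:
  assumes "u \<noteq> 0" "v \<noteq> 0" and "1 - 6 * \<beta> \<noteq> 0" and "\<alpha>1 \<noteq> \<alpha>2"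
  shows "proj_sign M X \<alpha>1 \<alpha>2 u v * lam M X \<alpha>1 \<alpha>2 u v
      * sqrt (1 + \<alpha>1 * \<alpha>2 * (lam M X \<alpha>1 \<alpha>2 u v)\<^sup>2) / sqrt (proj_moment 2 M X u v)
    = \<delta> u v / s u v"
proof -
  define m y x where "m = proj_moment 2 M X u v" and "y = s u v" and "x = \<delta> u v"
  have m: "m > 0" using proj_moment_2_pos[OF assms(1,2)] by (simp add: m_def)
  have y: "y > 0" using s_pos[OF assms(1,2)] by (simp add: y_def)
  have "1 + \<beta> * (\<bar>x\<bar> / sqrt y)\<^sup>2 = m / y"
    using y by (simp add: m_def proj_moments x_def[symmetric] y_def[symmetric] power_divide field_simps)
  then have "sgn x * (\<bar>x\<bar> / sqrt y) * sqrt (1 + \<beta> * (\<bar>x\<bar> / sqrt y)\<^sup>2) / sqrt m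
      = (sgn x * \<bar>x\<bar>) / (sqrt y * sqrt y)"
    using m y by (simp add: real_sqrt_divide)
  also have "\<dots> = x / y" using y by (simp add: sgn_mult_abs)
  finally show ?thesis
    by (simp add: lam_eq[OF assms(1-3)] proj_sign_eq[OF assms(4)] m_def y_def x_def)
qed

section \<open>Sequences of optimizers recover the discriminant matrix\<close>

text \<open>Common core of minimization and maximization: in both cases the optimizer maximizes the
  squared ratio of \<open>\<delta>\<^sup>2\<close> to the second moment, and this reduces to
  \<open>singular_sequence\<close>.\<close>

lemma optimizer_sequence_sum:
  assumes ne: "1 - 6 * \<beta> \<noteq> 0" "\<alpha>1 \<noteq> \<alpha>2"
    and feas: "\<And>j. j \<in> {1..rank (T2 - T1)} \<Longrightarrow>
      feasible (\<lambda>k. G1 M X (v k)) (\<lambda>k. G2 M X (u k)) u v j (u j, v j)"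
    and opt: "\<And>j x y. j \<in> {1..rank (T2 - T1)} \<Longrightarrow>
      feasible (\<lambda>k. G1 M X (v k)) (\<lambda>k. G2 M X (u k)) u v j (x, y) \<Longrightarrow>
      ((\<delta> x y)\<^sup>2 / proj_moment 2 M X x y)\<^sup>2 \<le> ((\<delta> (u j) (v j))\<^sup>2 / proj_moment 2 M X (u j) (v j))\<^sup>2"
  shows "(\<forall>j\<in>{1..rank (T2 - T1)}. proj_sign M X \<alpha>1 \<alpha>2 (u j) (v j) \<in> {-1, 1}) \<and>
    (\<Sum>j=1..rank (T2 - T1).
       (proj_sign M X \<alpha>1 \<alpha>2 (u j) (v j) * lam M X \<alpha>1 \<alpha>2 (u j) (v j)
          * sqrt (1 + \<alpha>1 * \<alpha>2 * (lam M X \<alpha>1 \<alpha>2 (u j) (v j))\<^sup>2)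
        / sqrt (proj_moment 2 M X (u j) (v j))) *\<^sub>R outer_prod (u j) (v j))
    = matrix_inv A ** (T2 - T1) ** matrix_inv B"
proof -
  let ?d = "rank (T2 - T1)"
  define F where "F j x y \<longleftrightarrow> (\<forall>k\<in>{1..<j}.
      (x \<bullet> (A *v u k)) * (v k \<bullet> (B *v v k)) + \<beta> * \<delta> x (v k) * \<delta> (u k) (v k) = 0 \<and>
      (y \<bullet> (B *v v k)) * (u k \<bullet> (A *v u k)) + \<beta> * \<delta> (u k) y * \<delta> (u k) (v k) = 0)" for j x y
  \<comment> \<open>The forms of \<open>G1\<close> and \<open>G2\<close> are exactly the coupled
    constraints treated in \<open>singular_sequence\<close>.\<close>
  have feasible_iff: "feasible (\<lambda>k. G1 M X (v k)) (\<lambda>k. G2 M X (u k)) u v j (x, y)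
      \<longleftrightarrow> norm x = 1 \<and> norm y = 1 \<and> F j x y" for j x y
    by (simp add: feasible_def F_def G1_form G2_form)
  have unit: "norm (u j) = 1" "norm (v j) = 1" if "j \<in> {1..?d}" for j
    using feas[OF that] by (simp_all add: feasible_iff)
  have nz: "u j \<noteq> 0" "v j \<noteq> 0" if "j \<in> {1..?d}" for j
    using unit[OF that] by auto
  have F: "F j (u j) (v j)" if "j \<in> {1..?d}" for j
    using feas[OF that] by (simp add: feasible_iff)
  have ratio: "(\<delta> x y)\<^sup>2 * s (u j) (v j) \<le> (\<delta> (u j) (v j))\<^sup>2 * s x y"
    if j: "j \<in> {1..?d}" and xy: "norm x = 1" "norm y = 1" "F j x y" for j x y
  proof -
    have "x \<noteq> 0" "y \<noteq> 0" using xy by auto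
    note pos = proj_moment_2_pos[OF this] proj_moment_2_pos[OF nz[OF j]]
    have "((\<delta> x y)\<^sup>2 / proj_moment 2 M X x y)\<^sup>2 \<le> ((\<delta> (u j) (v j))\<^sup>2 / proj_moment 2 M X (u j) (v j))\<^sup>2"
      by (rule opt[OF j]) (simp add: feasible_iff xy)
    then have "(\<delta> x y)\<^sup>2 / proj_moment 2 M X x y \<le> (\<delta> (u j) (v j))\<^sup>2 / proj_moment 2 M X (u j) (v j)"
      by (rule power2_le_imp_le) (use pos in simp)
    then have "(\<delta> x y)\<^sup>2 * proj_moment 2 M X (u j) (v j) \<le> (\<delta> (u j) (v j))\<^sup>2 * proj_moment 2 M X x y"
      using pos by (simp add: divide_le_eq le_divide_eq mult.commute)
    \<comment> \<open>After cross-multiplication both sides contain \<open>\<beta>\<close> times the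
      same product of squares; cancelling it replaces the second moments by
      \<open>s\<close>.\<close>
    then show ?thesis unfolding proj_moments by (simp add: algebra_simps)
  qed
  note seq = singular_sequence[where us = u and vs = v and \<beta> = \<beta> and d = ?d and D = "T2 - T1",
      OF A B less_imp_le[OF \<beta>_pos] refl]
  have nonzero: "\<delta> (u j) (v j) \<noteq> 0" if "j \<in> {1..?d}" for j
    by (rule seq(1)[OF _ _ _ _ that]) (rule nz F[unfolded F_def] ratio[unfolded F_def]; assumption)+
  have total: "(\<Sum>j=1..?d. (\<delta> (u j) (v j) / s (u j) (v j)) *\<^sub>R outer_prod (u j) (v j))
      = matrix_inv A ** (T2 - T1) ** matrix_inv B"
    by (rule seq(2)) (rule nz F[unfolded F_def] ratio[unfolded F_def]; assumption)+
  have "proj_sign M X \<alpha>1 \<alpha>2 (u j) (v j) \<in> {-1, 1}" if "j \<in> {1..?d}" for j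
    using nonzero[OF that] by (simp add: proj_sign_eq[OF ne(2)] sgn_if)
  moreover have "(\<Sum>j=1..?d.
       (proj_sign M X \<alpha>1 \<alpha>2 (u j) (v j) * lam M X \<alpha>1 \<alpha>2 (u j) (v j)
          * sqrt (1 + \<alpha>1 * \<alpha>2 * (lam M X \<alpha>1 \<alpha>2 (u j) (v j))\<^sup>2)
        / sqrt (proj_moment 2 M X (u j) (v j))) *\<^sub>R outer_prod (u j) (v j))
    = (\<Sum>j=1..?d. (\<delta> (u j) (v j) / s (u j) (v j)) *\<^sub>R outer_prod (u j) (v j))"
    by (intro sum.cong refl) (simp only: summand_coefficient[OF nz ne])
  ultimately show ?thesis using total by simp
qed

lemma feasible_nonzero:
  assumes "feasible H1 H2 us vs j (x, y)" shows "x \<noteq> 0" "y \<noteq> 0"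
  using assms by (auto simp: feasible_def)

text \<open>The factor \<open>\<beta> * (1 - 6 * \<beta>)\<close> is negative here, so a smaller
  kurtosis means a larger squared ratio.\<close>

lemma minimizer_sequence_sum:
  assumes "1 - 6 * \<beta> < 0" "\<alpha>1 \<noteq> \<alpha>2"
    and "minimizer_seq (rank (T2 - T1)) (\<lambda>k. G1 M X (v k)) (\<lambda>k. G2 M X (u k)) (kurt M X) u v"
  shows "(\<forall>j\<in>{1..rank (T2 - T1)}. proj_sign M X \<alpha>1 \<alpha>2 (u j) (v j) \<in> {-1, 1}) \<and>
    (\<Sum>j=1..rank (T2 - T1).
       (proj_sign M X \<alpha>1 \<alpha>2 (u j) (v j) * lam M X \<alpha>1 \<alpha>2 (u j) (v j)
          * sqrt (1 + \<alpha>1 * \<alpha>2 * (lam M X \<alpha>1 \<alpha>2 (u j) (v j))\<^sup>2)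
        / sqrt (proj_moment 2 M X (u j) (v j))) *\<^sub>R outer_prod (u j) (v j))
    = matrix_inv A ** (T2 - T1) ** matrix_inv B"
proof (rule optimizer_sequence_sum)
  fix j assume j: "j \<in> {1..rank (T2 - T1)}"
  show f: "feasible (\<lambda>k. G1 M X (v k)) (\<lambda>k. G2 M X (u k)) u v j (u j, v j)"
    using assms(3) j by (simp add: minimizer_seq_def is_arg_min_def)
  fix x y assume xy: "feasible (\<lambda>k. G1 M X (v k)) (\<lambda>k. G2 M X (u k)) u v j (x, y)"
  have "kurt M X (u j) (v j) \<le> kurt M X x y"
    using assms(3) j xy by (force simp: minimizer_seq_def is_arg_min_def not_less)
  then have "\<beta> * (1 - 6 * \<beta>) * ((\<delta> (u j) (v j))\<^sup>2 / proj_moment 2 M X (u j) (v j))\<^sup>2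
      \<le> \<beta> * (1 - 6 * \<beta>) * ((\<delta> x y)\<^sup>2 / proj_moment 2 M X x y)\<^sup>2"
    unfolding kurt_eq[OF feasible_nonzero[OF f]] kurt_eq[OF feasible_nonzero[OF xy]] by simp
  moreover have "\<beta> * (1 - 6 * \<beta>) < 0" using assms(1) \<beta>_pos by (rule mult_pos_neg[rotated])
  ultimately show "((\<delta> x y)\<^sup>2 / proj_moment 2 M X x y)\<^sup>2
      \<le> ((\<delta> (u j) (v j))\<^sup>2 / proj_moment 2 M X (u j) (v j))\<^sup>2"
    by (simp only: mult_le_cancel_left_neg)
qed (use assms in auto)

lemma maximizer_sequence_sum:
  assumes "1 - 6 * \<beta> > 0" "\<alpha>1 \<noteq> \<alpha>2"
    and "maximizer_seq (rank (T2 - T1)) (\<lambda>k. G1 M X (v k)) (\<lambda>k. G2 M X (u k)) (kurt M X) u v"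
  shows "(\<forall>j\<in>{1..rank (T2 - T1)}. proj_sign M X \<alpha>1 \<alpha>2 (u j) (v j) \<in> {-1, 1}) \<and>
    (\<Sum>j=1..rank (T2 - T1).
       (proj_sign M X \<alpha>1 \<alpha>2 (u j) (v j) * lam M X \<alpha>1 \<alpha>2 (u j) (v j)
          * sqrt (1 + \<alpha>1 * \<alpha>2 * (lam M X \<alpha>1 \<alpha>2 (u j) (v j))\<^sup>2)
        / sqrt (proj_moment 2 M X (u j) (v j))) *\<^sub>R outer_prod (u j) (v j))
    = matrix_inv A ** (T2 - T1) ** matrix_inv B"
proof (rule optimizer_sequence_sum)
  fix j assume j: "j \<in> {1..rank (T2 - T1)}"
  show f: "feasible (\<lambda>k. G1 M X (v k)) (\<lambda>k. G2 M X (u k)) u v j (u j, v j)"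
    using assms(3) j by (simp add: maximizer_seq_def is_arg_max_def)
  fix x y assume xy: "feasible (\<lambda>k. G1 M X (v k)) (\<lambda>k. G2 M X (u k)) u v j (x, y)"
  have "kurt M X x y \<le> kurt M X (u j) (v j)"
    using assms(3) j xy by (force simp: maximizer_seq_def is_arg_max_def not_less)
  then have "\<beta> * (1 - 6 * \<beta>) * ((\<delta> x y)\<^sup>2 / proj_moment 2 M X x y)\<^sup>2
      \<le> \<beta> * (1 - 6 * \<beta>) * ((\<delta> (u j) (v j))\<^sup>2 / proj_moment 2 M X (u j) (v j))\<^sup>2"
    unfolding kurt_eq[OF feasible_nonzero[OF f]] kurt_eq[OF feasible_nonzero[OF xy]] by simp
  moreover have "\<beta> * (1 - 6 * \<beta>) > 0" using \<beta>_pos assms(1) by (rule mult_pos_pos)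
  ultimately show "((\<delta> x y)\<^sup>2 / proj_moment 2 M X x y)\<^sup>2
      \<le> ((\<delta> (u j) (v j))\<^sup>2 / proj_moment 2 M X (u j) (v j))\<^sup>2"
    by (simp only: mult_le_cancel_left_pos)
qed (use assms in auto)

end

section \<open>The weight threshold and the three cases\<close>

text \<open>Squaring compares \<open>1/4 - a * (1 - a)\<close> with \<open>1/12\<close>, which
  places the threshold at \<open>a * (1 - a) = 1/6\<close>.\<close>

lemma distance_to_half_vs_kurtosis_sign:
  fixes a :: real
  shows "\<bar>a - 1/2\<bar> < 1 / sqrt 12 \<longleftrightarrow> 1 - 6 * (a * (1 - a)) < 0"
    and "\<bar>a - 1/2\<bar> = 1 / sqrt 12 \<longleftrightarrow> 1 - 6 * (a * (1 - a)) = 0"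
proof -
  have sq: "\<bar>1 / sqrt 12 :: real\<bar> = 1 / sqrt 12" "(1 / sqrt 12 :: real)\<^sup>2 = 1 / 12"
    by (simp_all add: power_divide)
  have a: "(a - 1/2)\<^sup>2 = 1/4 - a * (1 - a)" by (simp add: power2_eq_square field_simps)
  have "\<bar>a - 1/2\<bar> < \<bar>1 / sqrt 12\<bar> \<longleftrightarrow> (a - 1/2)\<^sup>2 < (1 / sqrt 12)\<^sup>2"
    using abs_le_square_iff[of "1 / sqrt 12" "a - 1/2"] by linarith
  then show "\<bar>a - 1/2\<bar> < 1 / sqrt 12 \<longleftrightarrow> 1 - 6 * (a * (1 - a)) < 0"
    unfolding sq a by linarith
  have "\<bar>a - 1/2\<bar> = \<bar>1 / sqrt 12\<bar> \<longleftrightarrow> (a - 1/2)\<^sup>2 = (1 / sqrt 12)\<^sup>2"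
    using abs_le_square_iff[of "1 / sqrt 12" "a - 1/2"] abs_le_square_iff[of "a - 1/2" "1 / sqrt 12"]
    by (metis order_antisym_conv order_refl)
  then show "\<bar>a - 1/2\<bar> = 1 / sqrt 12 \<longleftrightarrow> 1 - 6 * (a * (1 - a)) = 0"
    unfolding sq a by linarith
qed

theorem theorem1:
  fixes M :: "'a measure"
    and X :: "'a \<Rightarrow> real^'q^'p"
    and A :: "real^'p^'p" and B :: "real^'q^'q"
    and T1 T2 W_LDA :: "real^'q^'p"
    and \<alpha>1 \<alpha>2 :: real and d :: nat
  assumes "prob_space M" and "X \<in> borel_measurable M"
    and "\<alpha>1 \<in> {0<..<1}" and "\<alpha>2 = 1 - \<alpha>1"
    and "sym_pos_def A" and "sym_pos_def B"
    and "T1 \<noteq> T2"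
    and "distr M borel X = mixture \<alpha>1 (matrix_normal T1 A B) \<alpha>2 (matrix_normal T2 A B)"
    and "d = rank (T2 - T1)"
    and "W_LDA = matrix_inv A ** (T2 - T1) ** matrix_inv B"
  shows
    "(\<bar>\<alpha>1 - 1/2\<bar> < 1 / sqrt 12 \<and> \<alpha>1 \<noteq> 1/2 \<longrightarrow>
       (\<forall>u v. minimizer_seq d (\<lambda>k. G1 M X (v k)) (\<lambda>k. G2 M X (u k)) (kurt M X) u v \<longrightarrow>
          (\<forall>j\<in>{1..d}. proj_sign M X \<alpha>1 \<alpha>2 (u j) (v j) \<in> {-1, 1}) \<and>
          (\<Sum>j=1..d.
             (proj_sign M X \<alpha>1 \<alpha>2 (u j) (v j) * lam M X \<alpha>1 \<alpha>2 (u j) (v j)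
                * sqrt (1 + \<alpha>1 * \<alpha>2 * (lam M X \<alpha>1 \<alpha>2 (u j) (v j))\<^sup>2)
              / sqrt (proj_moment 2 M X (u j) (v j))) *\<^sub>R outer_prod (u j) (v j)) = W_LDA))
     \<and> (\<bar>\<alpha>1 - 1/2\<bar> = 1 / sqrt 12 \<longrightarrow>
       (\<forall>u\<in>sphere 0 1. \<forall>v\<in>sphere 0 1. kurt M X u v = 3))
     \<and> (\<bar>\<alpha>1 - 1/2\<bar> > 1 / sqrt 12 \<longrightarrow>
       (\<forall>u v. maximizer_seq d (\<lambda>k. G1 M X (v k)) (\<lambda>k. G2 M X (u k)) (kurt M X) u v \<longrightarrow>
          (\<forall>j\<in>{1..d}. proj_sign M X \<alpha>1 \<alpha>2 (u j) (v j) \<in> {-1, 1}) \<and>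
          (\<Sum>j=1..d.
             (proj_sign M X \<alpha>1 \<alpha>2 (u j) (v j) * lam M X \<alpha>1 \<alpha>2 (u j) (v j)
                * sqrt (1 + \<alpha>1 * \<alpha>2 * (lam M X \<alpha>1 \<alpha>2 (u j) (v j))\<^sup>2)
              / sqrt (proj_moment 2 M X (u j) (v j))) *\<^sub>R outer_prod (u j) (v j)) = W_LDA))"
proof -
  interpret matrix_normal_mixture M X A B T1 T2 \<alpha>1 \<alpha>2
    by (rule matrix_normal_mixture.intro; fact assms)
  note d = \<open>d = rank (T2 - T1)\<close> and W = \<open>W_LDA = matrix_inv A ** (T2 - T1) ** matrix_inv B\<close>
  have sign: "\<bar>\<alpha>1 - 1/2\<bar> < 1 / sqrt 12 \<longleftrightarrow> 1 - 6 * (\<alpha>1 * \<alpha>2) < 0"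
    "\<bar>\<alpha>1 - 1/2\<bar> = 1 / sqrt 12 \<longleftrightarrow> 1 - 6 * (\<alpha>1 * \<alpha>2) = 0"
    unfolding \<alpha>2 by (rule distance_to_half_vs_kurtosis_sign)+
  have half: "\<alpha>1 \<noteq> 1/2 \<longleftrightarrow> \<alpha>1 \<noteq> \<alpha>2" using \<alpha>2 by auto
  show ?thesis
    unfolding d W
  proof (intro conjI[OF _ conjI] impI allI ballI)
    fix u v
    assume "\<bar>\<alpha>1 - 1/2\<bar> < 1 / sqrt 12 \<and> \<alpha>1 \<noteq> 1/2"
    then have "1 - 6 * (\<alpha>1 * \<alpha>2) < 0" "\<alpha>1 \<noteq> \<alpha>2" using sign half by auto
    moreover assume "minimizer_seq (rank (T2 - T1)) (\<lambda>k. G1 M X (v k)) (\<lambda>k. G2 M X (u k)) (kurt M X) u v"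
    ultimately show "(\<forall>j\<in>{1..rank (T2 - T1)}. proj_sign M X \<alpha>1 \<alpha>2 (u j) (v j) \<in> {-1, 1}) \<and>
      (\<Sum>j=1..rank (T2 - T1).
         (proj_sign M X \<alpha>1 \<alpha>2 (u j) (v j) * lam M X \<alpha>1 \<alpha>2 (u j) (v j)
            * sqrt (1 + \<alpha>1 * \<alpha>2 * (lam M X \<alpha>1 \<alpha>2 (u j) (v j))\<^sup>2)
          / sqrt (proj_moment 2 M X (u j) (v j))) *\<^sub>R outer_prod (u j) (v j))
      = matrix_inv A ** (T2 - T1) ** matrix_inv B"
      by (rule minimizer_sequence_sum)
  next
    fix u :: "real^'p" and v :: "real^'q"
    assume "\<bar>\<alpha>1 - 1/2\<bar> = 1 / sqrt 12"
    then have "1 - 6 * (\<alpha>1 * \<alpha>2) = 0" using sign by simp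
    moreover assume "u \<in> sphere 0 1" "v \<in> sphere 0 1"
    then have "u \<noteq> 0" "v \<noteq> 0" by auto
    ultimately show "kurt M X u v = 3" by (simp add: kurt_eq)
  next
    fix u v
    assume *: "1 / sqrt 12 < \<bar>\<alpha>1 - 1/2\<bar>"
    then have "1 - 6 * (\<alpha>1 * \<alpha>2) > 0" using sign by linarith
    \<comment> \<open>At equal weights the distance to one half is zero and cannot exceed the
      positive threshold, so the third moment can determine the signs.\<close>
    moreover have "\<alpha>1 \<noteq> 1/2"
    proof
      assume "\<alpha>1 = 1/2"
      with * show False by simp
    qed
    then have "\<alpha>1 \<noteq> \<alpha>2" using half by simp
    moreover assume "maximizer_seq (rank (T2 - T1)) (\<lambda>k. G1 M X (v k)) (\<lambda>k. G2 M X (u k)) (kurt M X) u v"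
    ultimately show "(\<forall>j\<in>{1..rank (T2 - T1)}. proj_sign M X \<alpha>1 \<alpha>2 (u j) (v j) \<in> {-1, 1}) \<and>
      (\<Sum>j=1..rank (T2 - T1).
         (proj_sign M X \<alpha>1 \<alpha>2 (u j) (v j) * lam M X \<alpha>1 \<alpha>2 (u j) (v j)
            * sqrt (1 + \<alpha>1 * \<alpha>2 * (lam M X \<alpha>1 \<alpha>2 (u j) (v j))\<^sup>2)
          / sqrt (proj_moment 2 M X (u j) (v j))) *\<^sub>R outer_prod (u j) (v j))
      = matrix_inv A ** (T2 - T1) ** matrix_inv B"
      by (rule maximizer_sequence_sum)
  qed
qed

end
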